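(* Let $d\in\mathbb{N}$, let $\mathscr{D}$ be the standard dyadic system in $\mathbb{R}^d$, and let $X$ be an infinite-dimensional Banach lattice with the RMF property. Then there is no constant $C>0$ such that for all simple functions $f:\mathbb{R}^d\to X$ $$\bigl\|M^{\mathscr{D}}_{\mathrm{Lat}}f(s)\bigr\|_X\leq C\,M^{\mathscr{D}}_{\mathrm{Rad}}f(s),\qquad s\in\mathbb{R}^d.$$
   Context: The standard dyadic system in $\mathbb{R}^d$ is $\mathscr{D}=\{2^{-k}([0,1)^d+m):k\in\mathbb{Z},\,m\in\mathbb{Z}^d\}$. $\langle f\rangle_{1,Q}:=\frac{1}{|Q|}\int_Qf$. For a Banach lattice $X$ and simple $f:\mathbb{R}^d\to X$, the dyadic lattice Hardy–Littlewood maximal operator is $$M^{\mathscr{D}}_{\mathrm{Lat}}f(s):=\sup_{Q\in\mathscr{D}:\,s\in Q}\langle|f|\rangle_{1,Q}\in X,\qquad s\in\mathbb{R}^d,$$ with absolute value and supremum taken in the lattice sense. (A Banach lattice with the RMF property has nontrivial type, hence finite cotype, so the supremum exists.) For a countable collection of cubes $\mathcal{D}$ and locally integrable $X$-valued $f$, the Rademacher maximal function is $$M^{\mathcal{D}}_{\mathrm{Rad}}f(s):=\sup\Bigl\{\Bigl\|\sum_{Q\in\mathcal{D}:\,s\in Q}\varepsilon_Q\lambda_Q\langle f\rangle_{1,Q}\Bigr\|_{L^2(\Omega;X)}:(\lambda_Q)_{Q\in\mathcal{D}}\text{ finitely non-zero},\ \sum_{Q\in\mathcal{D}}|\lambda_Q|^2\leq1\Bigr\},$$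 where $(\varepsilon_Q)$ are independent random variables on a probability space $\Omega$ uniformly distributed on $\{z\in\mathbb{K}:|z|=1\}$, $\mathbb{K}$ the scalar field. $X$ has the RMF property if $M_{\mathrm{Rad}}^{\mathscr{D}[0,1)}$ is bounded from $L^p([0,1);X)$ to $L^p([0,1))$ for some $p\in(1,\infty)$, where $\mathscr{D}[0,1)=\{2^{-k}[j-1,j):k\in\mathbb{N}\cup\{0\},\,j=1,\ldots,2^k\}$. Pointwise inequalities are understood a.e. *)

theory Defs
  imports "HOL-Probability.Probability" "HOL-Library.Lattice_Algebras" "HOL-Library.Lub_Glb"
begin

section \<open>Banach lattices\<close>

class banach_lattice = banach + ordered_real_vector + lattice_ab_group_add_abs +
  assumes norm_mono_abs: "\<bar>x\<bar> \<le> \<bar>y\<bar> \<Longrightarrow> norm x \<le> norm y"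

text \<open>Neither a Banach lattice nor its complexification need be order complete, so a supremum is
  the least upper bound in the underlying order, when there is one (unspecified otherwise).\<close>

definition order_sup :: "'a::order set \<Rightarrow> 'a" where
  "order_sup S = (THE y. isLub UNIV S y)"

lemma order_sup_eqI:
  fixes y :: "'a::order"
  assumes "\<And>x. x \<in> S \<Longrightarrow> x \<le> y" and "\<And>b. (\<And>x. x \<in> S \<Longrightarrow> x \<le> b) \<Longrightarrow> y \<le> b"
  shows "order_sup S = y"
  unfolding order_sup_def isLub_def leastP_def isUb_def setle_def setge_def
  using assms by (intro the_equality) (auto intro!: antisym)

lemma norm_abs_lat [simp]: "norm \<bar>x\<bar> = norm (x :: 'a::banach_lattice)"
  by (rule antisym; rule norm_mono_abs) simp_all

lemma norm_mono_lat: "0 \<le> x \<Longrightarrow> x \<le> y \<Longrightarrow> norm x \<le> norm (y :: 'a::banach_lattice)"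
  using norm_mono_abs[of x y] order_trans[of 0 x y] by (simp add: abs_of_nonneg)

lemma abs_scaleR_lat: "\<bar>r *\<^sub>R x\<bar> = \<bar>r\<bar> *\<^sub>R \<bar>x :: 'a::banach_lattice\<bar>"
proof -
  have pos: "\<bar>r *\<^sub>R x\<bar> = r *\<^sub>R \<bar>x\<bar>" if "r > 0" for r and x :: 'a
  proof (rule antisym)
    have le: "\<bar>r *\<^sub>R x\<bar> \<le> r *\<^sub>R \<bar>x\<bar>" if "r > 0" for r and x :: 'a
      using that scaleR_left_mono[OF abs_ge_self[of x], of r]
        scaleR_left_mono[OF abs_ge_minus_self[of x], of r]
      by (intro abs_leI) auto
    show "\<bar>r *\<^sub>R x\<bar> \<le> r *\<^sub>R \<bar>x\<bar>" by (rule le[OF that])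
    from le[of "1 / r" "r *\<^sub>R x"] that have "\<bar>x\<bar> \<le> (1 / r) *\<^sub>R \<bar>r *\<^sub>R x\<bar>" by simp
    from scaleR_left_mono[OF this, of r] that show "r *\<^sub>R \<bar>x\<bar> \<le> \<bar>r *\<^sub>R x\<bar>" by simp
  qed
  consider "r > 0" | "r = 0" | "- r > 0" by linarith
  then show ?thesis
  proof cases
    case 3
    from pos[OF this, of x] have "\<bar>- (r *\<^sub>R x)\<bar> = (- r) *\<^sub>R \<bar>x\<bar>" by simp
    then show ?thesis using 3 by (simp only: abs_minus_cancel) simp
  qed (simp_all add: pos)
qed

lemma lat_limit_le:
  fixes a :: "'a::banach_lattice"
  assumes "u \<longlonglongrightarrow> a" and "\<And>n. u n \<le> b"
  shows "a \<le> b"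
proof -
  define c where "c = sup (a - b) 0"
  have c0: "0 \<le> c" by (simp add: c_def)
  have "norm c \<le> norm (a - u n)" for n
  proof -
    have "a - b \<le> a - u n" using assms(2)[of n] by simp
    also have "\<dots> \<le> \<bar>a - u n\<bar>" by (rule abs_ge_self)
    finally have "c \<le> \<bar>a - u n\<bar>" by (simp add: c_def)
    with c0 have "norm c \<le> norm \<bar>a - u n\<bar>" by (rule norm_mono_lat)
    then show ?thesis by simp
  qed
  moreover have "(\<lambda>n. norm (a - u n)) \<longlonglongrightarrow> norm (a - a)"
    by (intro tendsto_intros assms)
  ultimately have "norm c \<le> 0"
    by (intro LIMSEQ_le_const[of "\<lambda>n. norm (a - u n)"]) auto
  then have "c = 0" by simp
  moreover have "a - b \<le> c" by (simp add: c_def)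
  ultimately show ?thesis by simp
qed


section \<open>Complex Banach lattices\<close>

text \<open>A complex Banach lattice is the complexification \<open>E + iE\<close> of a real Banach lattice \<open>E\<close>, with
  modulus \<open>\<bar>x + iy\<bar> = sup\<^sub>\<theta> (cos \<theta> \<cdot> x + sin \<theta> \<cdot> y)\<close> in \<open>E\<close> and norm \<open>\<parallel>x + iy\<parallel> = \<parallel> \<bar>x + iy\<bar> \<parallel>\<close>.
  It is ordered by the positive cone of \<open>E\<close>, so that suprema of sets of moduli are the suprema
  in \<open>E\<close>.\<close>

datatype 'a complexification = Cx (rpart: 'a) (ipart: 'a)

lemma complexification_eq_iff: "z = w \<longleftrightarrow> rpart z = rpart w \<and> ipart z = ipart w"
  by (auto intro: complexification.expand)

definition rotated_part :: "'a::real_vector \<Rightarrow> 'a \<Rightarrow> real \<Rightarrow> 'a" where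
  "rotated_part x y \<theta> = cos \<theta> *\<^sub>R x + sin \<theta> *\<^sub>R y"

definition lat_modulus :: "'a::{real_vector,order} complexification \<Rightarrow> 'a" where
  "lat_modulus z = order_sup (range (rotated_part (rpart z) (ipart z)))"

lemma scaleR_le_abs:
  fixes x :: "'a::banach_lattice"
  shows "\<bar>r\<bar> \<le> s \<Longrightarrow> r *\<^sub>R x \<le> s *\<^sub>R \<bar>x\<bar>"
  by (rule order_trans[OF abs_ge_self]) (auto simp: abs_scaleR_lat intro: scaleR_right_mono)

lemma rotated_part_lipschitz:
  fixes x y :: "'a::banach_lattice"
  shows "rotated_part x y a \<le> rotated_part x y b + \<bar>a - b\<bar> *\<^sub>R (\<bar>x\<bar> + \<bar>y\<bar>)"
proof -
  have half: "\<bar>2 * (x * y)\<bar> \<le> \<bar>a - b\<bar>" if "\<bar>x\<bar> \<le> 1" "\<bar>y\<bar> \<le> \<bar>(a - b) / 2\<bar>" for x y :: real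
    using mult_mono[OF that] by (simp add: abs_mult)
  have c: "\<bar>cos a - cos b\<bar> \<le> \<bar>a - b\<bar>"
    using half[of "sin ((a + b) / 2)" "sin ((b - a) / 2)"] abs_sin_x_le_abs_x[of "(b - a) / 2"]
    by (simp add: cos_diff_cos abs_minus_commute mult.assoc)
  have s: "\<bar>sin a - sin b\<bar> \<le> \<bar>a - b\<bar>"
    using half[of "cos ((a + b) / 2)" "sin ((a - b) / 2)"] abs_sin_x_le_abs_x[of "(a - b) / 2"]
    by (simp add: sin_diff_sin mult.assoc mult.commute)
  have "rotated_part x y a - rotated_part x y b = (cos a - cos b) *\<^sub>R x + (sin a - sin b) *\<^sub>R y"
    by (simp add: rotated_part_def algebra_simps)
  also have "\<dots> \<le> \<bar>a - b\<bar> *\<^sub>R \<bar>x\<bar> + \<bar>a - b\<bar> *\<^sub>R \<bar>y\<bar>"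
    by (intro add_mono scaleR_le_abs c s)
  finally show ?thesis by (simp add: algebra_simps)
qed

lemma lat_modulus_exists:
  fixes x y :: "'a::banach_lattice"
  shows "\<exists>m. (\<forall>\<theta>. rotated_part x y \<theta> \<le> m) \<and> (\<forall>b. (\<forall>\<theta>. rotated_part x y \<theta> \<le> b) \<longrightarrow> m \<le> b)"
proof -
  define v where "v = rotated_part x y"
  define w where "w = \<bar>x\<bar> + \<bar>y\<bar>"
  have w0: "0 \<le> w" by (simp add: w_def)
  define u where
    "u n = Sup_fin (v ` (\<lambda>k. - pi + real k / real (Suc n)) ` {..7 * Suc n})" for n
  have u_le: "u n \<le> b" if "\<And>\<theta>. v \<theta> \<le> b" for n b
    unfolding u_def using that by (intro Sup_fin.boundedI) auto
  have v_le: "v \<theta> \<le> u n + (1 / real (Suc n)) *\<^sub>R w" for \<theta> n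
  proof -
    obtain t where t: "- pi \<le> t" "t \<le> pi" "sin t = sin \<theta>" "cos t = cos \<theta>"
    proof -
      have "cis (Arg (cis \<theta>)) = cis \<theta>" by (simp add: cis_Arg)
      then have "cos (Arg (cis \<theta>)) = cos \<theta>" "sin (Arg (cis \<theta>)) = sin \<theta>"
        by (simp_all only: complex_eq_iff cis.sel)
      then show ?thesis using that[of "Arg (cis \<theta>)"] Arg_bounded[of "cis \<theta>"] by auto
    qed
    define k where "k = nat \<lfloor>(t + pi) * real (Suc n)\<rfloor>"
    have pos: "0 \<le> (t + pi) * real (Suc n)" using t by (intro mult_nonneg_nonneg) auto
    then have k: "real k \<le> (t + pi) * real (Suc n)" "(t + pi) * real (Suc n) < real k + 1"
      unfolding k_def by linarith+
    have "(t + pi) * real (Suc n) \<le> 7 * real (Suc n)"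
      using t pi_approx by (intro mult_right_mono) auto
    also have "\<dots> = real (7 * Suc n)" by simp
    finally have "real k \<le> real (7 * Suc n)" using k(1) by (rule order_trans[rotated])
    then have kle: "k \<le> 7 * Suc n" by (simp only: of_nat_le_iff)
    have N: "0 < real (Suc n)" by simp
    have "real k / real (Suc n) \<le> t + pi" "t + pi \<le> (real k + 1) / real (Suc n)"
      using k by (simp_all only: pos_divide_le_eq[OF N] pos_le_divide_eq[OF N] less_imp_le)
    then have d: "\<bar>t - (- pi + real k / real (Suc n))\<bar> \<le> 1 / real (Suc n)"
      unfolding add_divide_distrib by linarith
    have "v \<theta> = v t" by (simp add: v_def rotated_part_def t)
    also have "\<dots> \<le> v (- pi + real k / real (Suc n)) +
        \<bar>t - (- pi + real k / real (Suc n))\<bar> *\<^sub>R w"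
      unfolding v_def w_def by (rule rotated_part_lipschitz)
    also have "\<dots> \<le> u n + (1 / real (Suc n)) *\<^sub>R w"
    proof (intro add_mono scaleR_right_mono w0 d)
      show "v (- pi + real k / real (Suc n)) \<le> u n"
        unfolding u_def using kle by (intro Sup_fin.coboundedI) auto
    qed
    finally show ?thesis .
  qed
  have diff: "u n - u m \<le> (1 / real (Suc m)) *\<^sub>R w" for n m
    using u_le[OF v_le, of n m] by (simp add: algebra_simps)
  have nd: "norm (u n - u m) \<le> (1 / real (Suc m)) * norm w" if "m \<le> n" for m n
  proof -
    have "(1 / real (Suc n)) *\<^sub>R w \<le> (1 / real (Suc m)) *\<^sub>R w"
      using that by (intro scaleR_right_mono w0) (auto simp: frac_le)
    with diff[of n m] diff[of m n] have "\<bar>u n - u m\<bar> \<le> (1 / real (Suc m)) *\<^sub>R w"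
      by (intro abs_leI) auto
    then have "norm \<bar>u n - u m\<bar> \<le> norm ((1 / real (Suc m)) *\<^sub>R w)"
      by (intro norm_mono_lat) auto
    then show ?thesis by simp
  qed
  have inv0: "(\<lambda>n. 1 / real (Suc n)) \<longlonglongrightarrow> 0"
    by (rule LIMSEQ_Suc[OF lim_1_over_n])
  then have lim0: "(\<lambda>m. (1 / real (Suc m)) * norm w) \<longlonglongrightarrow> 0"
    by (rule tendsto_mult_left_zero)
  have "Cauchy u"
  proof (rule metric_CauchyI)
    fix e :: real assume "e > 0"
    then obtain M where M: "(1 / real (Suc M)) * norm w < e / 2"
      using order_tendstoD(2)[OF lim0, of "e / 2"] unfolding eventually_sequentially by auto
    have "dist (u m) (u n) < e" if "m \<ge> M" "n \<ge> M" for m n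
      using nd[OF that(1)] nd[OF that(2)] M dist_triangle2[of "u m" "u n" "u M"]
      unfolding dist_norm by linarith
    then show "\<exists>M. \<forall>m\<ge>M. \<forall>n\<ge>M. dist (u m) (u n) < e" by blast
  qed
  then obtain m where m: "u \<longlonglongrightarrow> m"
    using Cauchy_convergent_iff convergent_def by blast
  have "v \<theta> \<le> m" for \<theta>
  proof -
    have "(\<lambda>n. v \<theta> - u n - (1 / real (Suc n)) *\<^sub>R w) \<longlonglongrightarrow> v \<theta> - m - 0 *\<^sub>R w"
      by (intro tendsto_intros m inv0)
    then have "v \<theta> - m - 0 *\<^sub>R w \<le> 0"
      by (rule lat_limit_le) (use v_le[of \<theta>] in \<open>simp add: algebra_simps\<close>)
    then show ?thesis by simp
  qed
  moreover have "m \<le> b" if "\<And>\<theta>. v \<theta> \<le> b" for b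
    by (rule lat_limit_le[OF m]) (rule u_le[OF that])
  ultimately show ?thesis unfolding v_def by blast
qed

lemma
  fixes z :: "'a::banach_lattice complexification"
  shows lat_modulus_ge: "rotated_part (rpart z) (ipart z) \<theta> \<le> lat_modulus z"
    and lat_modulus_le: "(\<And>\<theta>. rotated_part (rpart z) (ipart z) \<theta> \<le> b) \<Longrightarrow> lat_modulus z \<le> b"
proof -
  obtain m where m: "\<And>\<theta>. rotated_part (rpart z) (ipart z) \<theta> \<le> m"
    "\<And>b. (\<And>\<theta>. rotated_part (rpart z) (ipart z) \<theta> \<le> b) \<Longrightarrow> m \<le> b"
    using lat_modulus_exists[of "rpart z" "ipart z"] by blast
  then have "lat_modulus z = m"
    unfolding lat_modulus_def by (intro order_sup_eqI) auto
  with m show "rotated_part (rpart z) (ipart z) \<theta> \<le> lat_modulus z"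
    and "(\<And>\<theta>. rotated_part (rpart z) (ipart z) \<theta> \<le> b) \<Longrightarrow> lat_modulus z \<le> b" by auto
qed

lemma
  fixes z :: "'a::banach_lattice complexification"
  shows abs_rpart_le: "\<bar>rpart z\<bar> \<le> lat_modulus z" and abs_ipart_le: "\<bar>ipart z\<bar> \<le> lat_modulus z"
  using lat_modulus_ge[of z 0] lat_modulus_ge[of z pi]
    lat_modulus_ge[of z "pi / 2"] lat_modulus_ge[of z "- (pi / 2)"]
  by (auto intro!: abs_leI simp: rotated_part_def)

lemma lat_modulus_nonneg: "0 \<le> lat_modulus (z :: 'a::banach_lattice complexification)"
  using abs_rpart_le[of z] abs_ge_zero order_trans by blast

lemma lat_modulus_le_sum:
  "lat_modulus (z :: 'a::banach_lattice complexification) \<le> \<bar>rpart z\<bar> + \<bar>ipart z\<bar>"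
proof (rule lat_modulus_le)
  fix \<theta>
  have "rotated_part (rpart z) (ipart z) \<theta> \<le> 1 *\<^sub>R \<bar>rpart z\<bar> + 1 *\<^sub>R \<bar>ipart z\<bar>"
    unfolding rotated_part_def by (intro add_mono scaleR_le_abs) auto
  then show "rotated_part (rpart z) (ipart z) \<theta> \<le> \<bar>rpart z\<bar> + \<bar>ipart z\<bar>" by simp
qed

instantiation complexification :: (real_vector) real_vector
begin
definition "0 = Cx 0 0"
definition "z + w = Cx (rpart z + rpart w) (ipart z + ipart w)"
definition "- z = Cx (- rpart z) (- ipart z)"
definition "z - w = Cx (rpart z - rpart w) (ipart z - ipart w)"
definition "r *\<^sub>R z = Cx (r *\<^sub>R rpart z) (r *\<^sub>R ipart z)"
instance
  by standard (auto simp: zero_complexification_def plus_complexification_def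
    uminus_complexification_def minus_complexification_def scaleR_complexification_def
    algebra_simps)
end

lemmas complexification_ops = zero_complexification_def plus_complexification_def
  uminus_complexification_def minus_complexification_def scaleR_complexification_def

definition scaleC :: "complex \<Rightarrow> 'a::real_vector complexification \<Rightarrow> 'a complexification" where
  "scaleC c z = Cx (Re c *\<^sub>R rpart z - Im c *\<^sub>R ipart z) (Re c *\<^sub>R ipart z + Im c *\<^sub>R rpart z)"

lemma lat_modulus_triangle:
  fixes z w :: "'a::banach_lattice complexification"
  shows "lat_modulus (z + w) \<le> lat_modulus z + lat_modulus w"
proof (rule lat_modulus_le)
  fix \<theta>
  show "rotated_part (rpart (z + w)) (ipart (z + w)) \<theta> \<le> lat_modulus z + lat_modulus w"
    using add_mono[OF lat_modulus_ge[of z \<theta>] lat_modulus_ge[of w \<theta>]]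
    by (simp add: rotated_part_def complexification_ops algebra_simps)
qed

lemma lat_modulus_scaleC:
  fixes z :: "'a::banach_lattice complexification"
  shows "lat_modulus (scaleC c z) = cmod c *\<^sub>R lat_modulus z"
proof (rule antisym)
  have le: "lat_modulus (scaleC c z) \<le> cmod c *\<^sub>R lat_modulus z" for c
    and z :: "'a complexification"
  proof (rule lat_modulus_le)
    fix \<theta>
    obtain t where "c = rcis (cmod c) t" using rcis_cmod_Arg[of c] by metis
    then have re: "Re c = cmod c * cos t" and im: "Im c = cmod c * sin t"
      by (metis Re_rcis, metis Im_rcis)
    have "rotated_part (rpart (scaleC c z)) (ipart (scaleC c z)) \<theta>
        = cmod c *\<^sub>R rotated_part (rpart z) (ipart z) (\<theta> - t)"
      unfolding rotated_part_def scaleC_def complexification.sel re im cos_diff sin_diff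
      by (simp add: algebra_simps)
    also have "\<dots> \<le> cmod c *\<^sub>R lat_modulus z"
      by (intro scaleR_left_mono lat_modulus_ge) auto
    finally show "rotated_part (rpart (scaleC c z)) (ipart (scaleC c z)) \<theta>
        \<le> cmod c *\<^sub>R lat_modulus z" .
  qed
  show "lat_modulus (scaleC c z) \<le> cmod c *\<^sub>R lat_modulus z" by (rule le)
  show "cmod c *\<^sub>R lat_modulus z \<le> lat_modulus (scaleC c z)"
  proof (cases "c = 0")
    case True
    then show ?thesis by (simp add: lat_modulus_nonneg)
  next
    case False
    have comp: "scaleC a (scaleC b z) = scaleC (a * b) z" for a b
      by (simp add: scaleC_def algebra_simps)
    have "scaleC (inverse c) (scaleC c z) = scaleC 1 z"
      using False unfolding comp by simp
    then have "scaleC (inverse c) (scaleC c z) = z" by (simp add: scaleC_def)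
    then have "lat_modulus z \<le> cmod (inverse c) *\<^sub>R lat_modulus (scaleC c z)"
      using le[of "inverse c" "scaleC c z"] by simp
    from scaleR_left_mono[OF this, of "cmod c"] False show ?thesis
      by (simp add: norm_inverse)
  qed
qed

lemma lat_modulus_scaleR:
  fixes z :: "'a::banach_lattice complexification"
  shows "lat_modulus (r *\<^sub>R z) = \<bar>r\<bar> *\<^sub>R lat_modulus z"
proof -
  have "r *\<^sub>R z = scaleC (complex_of_real r) z"
    by (simp add: scaleC_def complexification_ops)
  then show ?thesis by (simp add: lat_modulus_scaleC)
qed

instantiation complexification :: (banach_lattice) real_normed_vector
begin
definition "norm z = norm (lat_modulus z)"
definition "sgn z = z /\<^sub>R norm (z :: 'a complexification)"
definition "dist z w = norm (z - w :: 'a complexification)"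
definition uniformity_complexification_def [code del]:
  "(uniformity :: ('a complexification \<times> 'a complexification) filter) =
    (INF e\<in>{0 <..}. principal {(x, y). dist x y < e})"
definition open_complexification_def [code del]:
  "open (U :: 'a complexification set) \<longleftrightarrow>
    (\<forall>x\<in>U. eventually (\<lambda>(x', y). x' = x \<longrightarrow> y \<in> U) uniformity)"
instance
proof
  fix r :: real and z w :: "'a complexification"
  have "norm (rpart z) \<le> norm z" "norm (ipart z) \<le> norm z"
    unfolding norm_complexification_def
    using norm_mono_lat[OF abs_ge_zero abs_rpart_le[of z]]
      norm_mono_lat[OF abs_ge_zero abs_ipart_le[of z]] by simp_all
  moreover have "lat_modulus z \<le> 0" if "z = 0"
    using lat_modulus_le_sum[of z] that by (simp add: complexification_ops)
  ultimately show "norm z = 0 \<longleftrightarrow> z = 0"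
    using lat_modulus_nonneg[of z]
    by (cases z) (auto simp: complexification_ops norm_complexification_def)
  show "norm (z + w) \<le> norm z + norm w"
    unfolding norm_complexification_def
    using norm_mono_lat[OF lat_modulus_nonneg lat_modulus_triangle[of z w]] norm_triangle_ineq
    by (rule order_trans)
  show "norm (r *\<^sub>R z) = \<bar>r\<bar> * norm z"
    by (simp add: norm_complexification_def lat_modulus_scaleR)
qed (rule sgn_complexification_def dist_complexification_def open_complexification_def
  uniformity_complexification_def)+
end

lemma norm_parts_le:
  fixes z :: "'a::banach_lattice complexification"
  shows "norm (rpart z) \<le> norm z" "norm (ipart z) \<le> norm z"
  unfolding norm_complexification_def
  using norm_mono_lat[OF abs_ge_zero abs_rpart_le[of z]]
    norm_mono_lat[OF abs_ge_zero abs_ipart_le[of z]] by simp_all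

lemma norm_le_parts:
  fixes z :: "'a::banach_lattice complexification"
  shows "norm z \<le> norm (rpart z) + norm (ipart z)"
proof -
  have "norm z \<le> norm (\<bar>rpart z\<bar> + \<bar>ipart z\<bar>)"
    unfolding norm_complexification_def
    by (intro norm_mono_lat lat_modulus_nonneg lat_modulus_le_sum)
  also have "\<dots> \<le> norm (rpart z) + norm (ipart z)"
    using norm_triangle_ineq[of "\<bar>rpart z\<bar>" "\<bar>ipart z\<bar>"] by simp
  finally show ?thesis .
qed

instance complexification :: (banach_lattice) banach
proof
  fix X :: "nat \<Rightarrow> 'a complexification"
  assume X: "Cauchy X"
  have sub: "rpart (z - w) = rpart z - rpart w" "ipart (z - w) = ipart z - ipart w"
    for z w :: "'a complexification" by (simp_all add: complexification_ops)
  have le: "dist (rpart z) (rpart w) \<le> dist z w" "dist (ipart z) (ipart w) \<le> dist z w"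
    for z w :: "'a complexification"
    using norm_parts_le[of "z - w"] by (simp_all add: dist_norm sub)
  have Cauchy_comp: "Cauchy (\<lambda>n. g (X n))"
    if g: "\<And>z w. dist (g z) (g w) \<le> dist z w" for g :: "'a complexification \<Rightarrow> 'a"
  proof (rule metric_CauchyI)
    fix e :: real assume "e > 0"
    from metric_CauchyD[OF X this] obtain M where "\<And>m n. m \<ge> M \<Longrightarrow> n \<ge> M \<Longrightarrow> dist (X m) (X n) < e"
      by auto
    then show "\<exists>M. \<forall>m\<ge>M. \<forall>n\<ge>M. dist (g (X m)) (g (X n)) < e"
      by (intro exI[of _ M] allI impI le_less_trans[OF g])
  qed
  obtain a where a: "(\<lambda>n. rpart (X n)) \<longlonglongrightarrow> a"
    using Cauchy_convergent[OF Cauchy_comp[of rpart, OF le(1)]] by (auto simp: convergent_def)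
  obtain b where b: "(\<lambda>n. ipart (X n)) \<longlonglongrightarrow> b"
    using Cauchy_convergent[OF Cauchy_comp[of ipart, OF le(2)]] by (auto simp: convergent_def)
  have "(\<lambda>n. norm (rpart (X n) - a) + norm (ipart (X n) - b)) \<longlonglongrightarrow> norm (a - a) + norm (b - b)"
    by (intro tendsto_intros a b)
  then have "(\<lambda>n. norm (rpart (X n) - a) + norm (ipart (X n) - b)) \<longlonglongrightarrow> 0" by simp
  then have "(\<lambda>n. X n - Cx a b) \<longlonglongrightarrow> 0"
  proof (rule Lim_null_comparison[OF always_eventually, rotated], intro allI)
    fix n
    show "norm (X n - Cx a b) \<le> norm (rpart (X n) - a) + norm (ipart (X n) - b)"
      using norm_le_parts[of "X n - Cx a b"] by (simp add: sub)
  qed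
  then have "X \<longlonglongrightarrow> Cx a b" by (rule LIM_zero_cancel)
  then show "convergent X" by (rule convergentI)
qed

lemma norm_scaleC:
  "norm (scaleC c z) = cmod c * norm (z :: 'a::banach_lattice complexification)"
  by (simp add: norm_complexification_def lat_modulus_scaleC)

interpretation complex_vector: vector_space scaleC
  by standard (auto simp: scaleC_def complexification_ops complexification_eq_iff algebra_simps)

instantiation complexification :: (banach_lattice) ordered_real_vector
begin
definition "z \<le> w \<longleftrightarrow> rpart z \<le> rpart w \<and> ipart z = ipart w"
definition "z < w \<longleftrightarrow> z \<le> w \<and> \<not> w \<le> (z :: 'a complexification)"
instance
  by standard
    (auto simp: less_eq_complexification_def less_complexification_def complexification_ops
      complexification_eq_iff intro: scaleR_left_mono scaleR_right_mono)
end

instantiation complexification :: (banach_lattice) abs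
begin
definition "\<bar>z\<bar> = Cx (lat_modulus z) 0"
instance ..
end


section \<open>Bochner integral and averages\<close>

text \<open>The library's Bochner integral is restricted to second countable target spaces. The
  definitions below are the usual ones, for an arbitrary Banach space.\<close>

definition strongly_measurable :: "'s measure \<Rightarrow> ('s \<Rightarrow> 'x::real_normed_vector) \<Rightarrow> bool" where
  "strongly_measurable M f \<longleftrightarrow>
    (\<exists>u. (\<forall>i. simple_function M (u i)) \<and> (AE s in M. (\<lambda>i. u i s) \<longlonglongrightarrow> f s))"

definition has_Bochner_integral :: "'s measure \<Rightarrow> ('s \<Rightarrow> 'x::real_normed_vector) \<Rightarrow> 'x \<Rightarrow> bool" where
  "has_Bochner_integral M f I \<longleftrightarrow> strongly_measurable M f \<and>
    (\<exists>u. (\<forall>i. Bochner_Integration.simple_bochner_integrable M (u i)) \<and>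
      (\<lambda>i. \<integral>\<^sup>+s. ennreal (norm (f s - u i s)) \<partial>M) \<longlonglongrightarrow> 0 \<and>
      (\<lambda>i. Bochner_Integration.simple_bochner_integral M (u i)) \<longlonglongrightarrow> I)"

definition Bochner_integral :: "'s measure \<Rightarrow> ('s \<Rightarrow> 'x::real_normed_vector) \<Rightarrow> 'x" where
  "Bochner_integral M f = (THE I. has_Bochner_integral M f I)"

definition average :: "'s::euclidean_space set \<Rightarrow> ('s \<Rightarrow> 'x::real_normed_vector) \<Rightarrow> 'x" where
  "average Q f = (1 / measure lebesgue Q) *\<^sub>R Bochner_integral (lebesgue_on Q) f"


section \<open>Dyadic cubes and maximal operators\<close>

definition dyadic_cubes :: "(real ^ 'n) set set" where
  "dyadic_cubes =
    {(\<lambda>x. (2 powi (- k)) *\<^sub>R (x + m)) ` {x. \<forall>i. x $ i \<in> {0..<1}} | (k::int) m. \<forall>i. m $ i \<in> \<int>}"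

definition dyadic_unit_intervals :: "real set set" where
  "dyadic_unit_intervals =
    {{real (j - 1) / 2 ^ k ..< real j / 2 ^ k} | (k::nat) (j::nat). 1 \<le> j \<and> j \<le> 2 ^ k}"

definition lattice_maximal ::
  "'s::euclidean_space set set \<Rightarrow> ('s \<Rightarrow> 'x::{real_normed_vector,order,abs}) \<Rightarrow> 's \<Rightarrow> 'x" where
  "lattice_maximal \<D> f s = order_sup {average Q (\<lambda>t. \<bar>f t\<bar>) | Q. Q \<in> \<D> \<and> s \<in> Q}"

text \<open>The scalar field is a type \<open>'k\<close> of class \<open>{real_normed_field, euclidean_space}\<close> (in
  practice \<open>real\<close> or \<open>complex\<close>), and \<open>scl\<close> is the scalar multiplication. The uniform distribution
  on the unit sphere of \<open>'k\<close> is the law of \<open>z / \<bar>z\<bar>\<close> for \<open>z\<close> uniform in the unit ball: random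
  signs for \<open>real\<close>, Steinhaus variables for \<open>complex\<close>. The sequence \<open>\<epsilon>\<close> is realised by the
  coordinates of a product space; only its law enters.\<close>

definition uniform_sphere :: "'k::euclidean_space measure" where
  "uniform_sphere = distr (uniform_measure lborel (ball 0 1)) borel sgn"

definition rademacher_maximal ::
  "('k::{real_normed_field,euclidean_space} \<Rightarrow> 'x \<Rightarrow> 'x) \<Rightarrow> 's::euclidean_space set set \<Rightarrow>
    ('s \<Rightarrow> 'x::real_normed_vector) \<Rightarrow> 's \<Rightarrow> ennreal" where
  "rademacher_maximal scl \<D> f s =
    (SUP c \<in> {c :: 's set \<Rightarrow> 'k. finite {Q \<in> \<D>. c Q \<noteq> 0} \<and>
        (\<Sum>Q \<in> {Q \<in> \<D>. c Q \<noteq> 0}. (norm (c Q))\<^sup>2) \<le> 1}.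
      ennreal (sqrt (\<integral>\<epsilon>. (norm (\<Sum>Q \<in> {Q \<in> \<D>. s \<in> Q \<and> c Q \<noteq> 0}.
          scl (\<epsilon> Q) (scl (c Q) (average Q f))))\<^sup>2
        \<partial>(\<Pi>\<^sub>M Q\<in>\<D>. (uniform_sphere :: 'k measure)))))"

text \<open>Boundedness of the \<open>ennreal\<close>-valued maximal function in \<open>L\<^sup>p\<close> is finiteness a.e. together
  with the norm inequality (raised to the power \<open>p\<close>).\<close>

definition RMF_property ::
  "('k::{real_normed_field,euclidean_space} \<Rightarrow> 'x \<Rightarrow> 'x::real_normed_vector) \<Rightarrow> bool" where
  "RMF_property scl \<longleftrightarrow>
    (\<exists>p>1. \<exists>C\<ge>0. \<forall>f :: real \<Rightarrow> 'x.
      strongly_measurable (lebesgue_on {0..<1}) f \<and>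
      (\<integral>\<^sup>+s. ennreal (norm (f s) powr p) \<partial>lebesgue_on {0..<1}) < \<infinity> \<longrightarrow>
      (AE s in lebesgue_on {0..<1}. rademacher_maximal scl dyadic_unit_intervals f s < \<infinity>) \<and>
      (\<integral>\<^sup>+s. ennreal (enn2real (rademacher_maximal scl dyadic_unit_intervals f s) powr p)
          \<partial>lebesgue_on {0..<1})
        \<le> ennreal (C powr p) * (\<integral>\<^sup>+s. ennreal (norm (f s) powr p) \<partial>lebesgue_on {0..<1}))"

definition infinite_dimensional :: "('k::field \<Rightarrow> 'x::ab_group_add \<Rightarrow> 'x) \<Rightarrow> bool" where
  "infinite_dimensional scl \<longleftrightarrow> \<not> (\<exists>B. finite B \<and> module.span scl B = UNIV)"

end

theory Submission
  imports Defs
begin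

text \<open>Suppose that the comparison holds with constant \<open>C\<close>. Testing it on functions that take disjoint
  positive values \<open>x j\<close> on growing dyadic annuli gives
  \<open>\<parallel>\<Sum>j. x j\<parallel> \<le> 2 C sup \<parallel>\<Sum>j. \<mu> j \<cdot> x j\<parallel>\<close>, the supremum being over the unit ball of \<open>\<ell>\<^sup>2\<close>; applied
  twice this becomes \<open>\<parallel>\<Sum>j. x j\<parallel> \<le> 4 C\<^sup>2 max \<parallel>x j\<parallel>\<close>. An infinite-dimensional Banach
  lattice has arbitrarily long sequences of disjoint normalised elements, so it would contain
  \<open>\<ell>\<^sup>\<infinity>\<close> of dimension \<open>2\<^sup>n\<close> uniformly in \<open>n\<close>, hence also \<open>\<ell>\<^sup>1\<close> of dimension \<open>n\<close>,
  spanned by Rademacher sums. The function on [0,1) whose values are the \<open>\<ell>\<^sup>1\<close> basis vectors, one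
  on each small dyadic interval, then violates the RMF property.\<close>

section \<open>Disjoint elements of Banach lattices\<close>

text \<open>Both estimates of the Rademacher maximal function hold for every single choice of
  unimodular scalars, so that passing to \<open>L^2(\<Omega>)\<close> is immediate. Disjointness
  allows this: the modulus of the sum of the \<open>c j x j\<close> is at most the sum of the
  \<open>|c j| x j\<close>, and for real coefficients at least each single \<open>|c j| x j\<close>.
  Annuli are used because the average of the \<open>j\<close>-th one is a fixed proportion on the
  \<open>j\<close>-th cube and decays geometrically on the larger cubes: the matrix of averages is
  then a contraction on \<open>l^2\<close>, while the lattice supremum still sees all the
  \<open>x j\<close> at once. The proportion is at least 1/2, which costs a factor 2 in each
  application and explains \<open>4 C^2\<close>. The contradiction at the end is quantitative:
  \<open>K\<close> levels in [0,1) give \<open>4^K\<close> small intervals and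
  \<open>2^(4^K)\<close> disjoint vectors indexed by sets of intervals; the test function is bounded
  by \<open>4 C^2\<close> whatever \<open>K\<close> is, whereas equal weights
  \<open>1 / sqrt K\<close> on the \<open>K\<close> intervals around a point make the maximal
  function at least a fixed multiple of \<open>sqrt K\<close>.\<close>

lemma inf_add_le_lat:
  fixes a b c :: "'a::banach_lattice"
  assumes "0 \<le> a" "0 \<le> b" "0 \<le> c"
  shows "inf a (b + c) \<le> inf a b + inf a c"
proof -
  have "inf a (b + c) \<le> a" "inf a (b + c) \<le> b + c" by auto
  \<comment> \<open>\<open>inf a b + inf a c\<close> is the infimum of the four sums
    \<open>a + a\<close>, \<open>a + c\<close>, \<open>b + a\<close>, \<open>b + c\<close>; each of
    them lies above \<open>a\<close> or equals \<open>b + c\<close>.\<close>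
  moreover have "a \<le> a + a" "a \<le> a + c" "a \<le> b + a" using assms by auto
  ultimately show ?thesis
    by (auto simp: add_inf_distrib_left add_inf_distrib_right intro: le_infI1 le_infI2)
qed

text \<open>Divided by a number \<open>m\<close> above both factors, the infimum becomes a common
  lower bound of \<open>x\<close> and \<open>y\<close>. The \<open>+ 1\<close> in \<open>m\<close>
  keeps it positive when both factors are 0.\<close>

lemma inf_scaleR_eq_0_lat:
  fixes x y :: "'a::banach_lattice"
  assumes "inf x y = 0" "0 \<le> r" "0 \<le> t"
  shows "inf (r *\<^sub>R x) (t *\<^sub>R y) = 0"
proof (rule antisym)
  have xy: "0 \<le> x" "0 \<le> y" using assms(1) by (metis inf_le1, metis inf_le2)
  define m where "m = max r t + 1"
  define w where "w = inf (r *\<^sub>R x) (t *\<^sub>R y)"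
  have m: "m > 0" "r \<le> m" "t \<le> m" using assms by (auto simp: m_def)
  have "w \<le> m *\<^sub>R x" "w \<le> m *\<^sub>R y"
    unfolding w_def
    by (rule le_infI1, rule scaleR_right_mono[OF m(2) xy(1)],
      rule le_infI2, rule scaleR_right_mono[OF m(3) xy(2)])
  then have "(1 / m) *\<^sub>R w \<le> (1 / m) *\<^sub>R (m *\<^sub>R x)" "(1 / m) *\<^sub>R w \<le> (1 / m) *\<^sub>R (m *\<^sub>R y)"
    using m by (auto intro!: scaleR_left_mono simp del: scaleR_scaleR)
  then have "(1 / m) *\<^sub>R w \<le> inf x y" using m by simp
  then have "m *\<^sub>R ((1 / m) *\<^sub>R w) \<le> m *\<^sub>R 0" using m assms by (intro scaleR_left_mono) auto
  then show "inf (r *\<^sub>R x) (t *\<^sub>R y) \<le> 0" using m by (simp add: w_def)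
  show "0 \<le> inf (r *\<^sub>R x) (t *\<^sub>R y)" using xy assms by (auto intro: scaleR_nonneg_nonneg)
qed

text \<open>Zero members are allowed, which makes the notion stable under nonnegative coefficients;
  \<open>orthogonal_set\<close> excludes them, because there the cardinality has to count disjoint
  elements.\<close>

definition disjoint_pos :: "'i set \<Rightarrow> ('i \<Rightarrow> 'a::banach_lattice) \<Rightarrow> bool" where
  "disjoint_pos I x \<longleftrightarrow>
    (\<forall>i\<in>I. 0 \<le> x i) \<and> (\<forall>i\<in>I. \<forall>j\<in>I. i \<noteq> j \<longrightarrow> inf (x i) (x j) = 0)"

lemma disjoint_pos_scaleR:
  "disjoint_pos I x \<Longrightarrow> (\<And>i. i \<in> I \<Longrightarrow> 0 \<le> r i) \<Longrightarrow> disjoint_pos I (\<lambda>i. r i *\<^sub>R x i)"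
  by (auto simp: disjoint_pos_def inf_scaleR_eq_0_lat scaleR_nonneg_nonneg)

lemma inf_sum_eq_0_lat:
  fixes u :: "'a::banach_lattice"
  assumes "finite I" "0 \<le> u" "\<And>i. i \<in> I \<Longrightarrow> 0 \<le> x i" "\<And>i. i \<in> I \<Longrightarrow> inf u (x i) = 0"
  shows "inf u (sum x I) = 0"
  using assms
proof (induction I rule: finite_induct)
  case empty
  then show ?case by (simp add: inf_absorb2)
next
  case (insert i I)
  then have "inf u (x i + sum x I) \<le> inf u (x i) + inf u (sum x I)"
    by (intro inf_add_le_lat) (auto intro: sum_nonneg)
  also have "\<dots> = 0" using insert by simp
  finally show ?case
    using insert by (intro antisym) (auto intro!: sum_nonneg add_nonneg_nonneg)
qed

text \<open>A sum of disjoint positive elements is their supremum, by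
  \<open>a + b = inf a b + sup a b\<close>. This is how bounds from single cubes combine to one for
  the whole sum in the lattice maximal function.\<close>

lemma disjoint_pos_sum_le:
  fixes b :: "'a::banach_lattice"
  assumes "finite I" "disjoint_pos I x" "0 \<le> b" "\<And>i. i \<in> I \<Longrightarrow> x i \<le> b"
  shows "sum x I \<le> b"
  using assms
proof (induction I rule: finite_induct)
  case (insert i I)
  then have d: "disjoint_pos I x" and p: "0 \<le> x i" "\<And>j. j \<in> I \<Longrightarrow> 0 \<le> x j"
    and o: "\<And>j. j \<in> I \<Longrightarrow> inf (x i) (x j) = 0"
    by (auto simp: disjoint_pos_def)
  have "inf (x i) (sum x I) = 0" by (rule inf_sum_eq_0_lat[OF insert.hyps(1) p o])
  then have "x i + sum x I = sup (x i) (sum x I)" using add_eq_inf_sup[of "x i" "sum x I"] by simp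
  moreover have "sum x I \<le> b" using insert.IH[OF d insert.prems(2)] insert.prems(3) by blast
  ultimately show ?case using insert.hyps insert.prems(3)[of i] by simp
qed simp

text \<open>The \<open>j\<close>-th term is the whole sum \<open>z\<close> minus the other terms, so
  \<open>u\<close> is at most \<open>\<bar>z\<bar> + R\<close>. As \<open>u\<close> is disjoint from
  \<open>R\<close>, subadditivity of \<open>inf\<close> removes \<open>R\<close>.\<close>

lemma disjoint_pos_abs_sum_ge:
  fixes x :: "'i \<Rightarrow> 'a::banach_lattice"
  assumes I: "finite I" and x: "disjoint_pos I x" and j: "j \<in> I"
  shows "\<bar>a j\<bar> *\<^sub>R x j \<le> \<bar>\<Sum>i\<in>I. a i *\<^sub>R x i\<bar>"
proof -
  define z r R u where "z = (\<Sum>i\<in>I. a i *\<^sub>R x i)" and "r = (\<Sum>i\<in>I-{j}. a i *\<^sub>R x i)"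
    and "R = (\<Sum>i\<in>I-{j}. \<bar>a i\<bar> *\<^sub>R x i)" and "u = \<bar>a j\<bar> *\<^sub>R x j"
  have p: "0 \<le> x i" if "i \<in> I" for i using x that by (auto simp: disjoint_pos_def)
  have u0: "0 \<le> u" using p[OF j] by (auto simp: u_def intro: scaleR_nonneg_nonneg)
  have R0: "0 \<le> R" using p by (auto simp: R_def intro!: sum_nonneg scaleR_nonneg_nonneg)
  have "\<bar>r\<bar> \<le> R"
    unfolding r_def R_def by (intro abs_leI, simp_all only: sum_negf[symmetric])
     (auto intro!: sum_mono scaleR_right_mono p simp flip: scaleR_minus_left)
  moreover have "u = \<bar>z - r\<bar>"
    using I j p[OF j] by (simp add: z_def r_def u_def sum.remove abs_scaleR_lat abs_of_nonneg)
  ultimately have "u \<le> \<bar>z\<bar> + R"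
    using abs_triangle_ineq4[of z r] by (metis add_left_mono order_trans)
  then have "u = inf u (\<bar>z\<bar> + R)" by (simp add: inf_absorb1)
  also have "\<dots> \<le> inf u \<bar>z\<bar> + inf u R" using u0 R0 by (intro inf_add_le_lat) auto
  also have "inf u R = 0"
    unfolding R_def u_def using I x j p
    by (intro inf_sum_eq_0_lat)
      (auto intro!: scaleR_nonneg_nonneg inf_scaleR_eq_0_lat simp: disjoint_pos_def)
  finally show ?thesis by (simp add: u_def z_def)
qed

section \<open>Atoms, and long disjoint sequences in infinite dimension\<close>

definition orthogonal_set :: "'a::banach_lattice set \<Rightarrow> bool" where
  "orthogonal_set A \<longleftrightarrow> (\<forall>a\<in>A. 0 < a) \<and> (\<forall>a\<in>A. \<forall>b\<in>A. a \<noteq> b \<longrightarrow> inf a b = 0)"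

text \<open>Phrased through disjoint pairs, not by saying that the interval from 0 to
  \<open>a\<close> consists of multiples of \<open>a\<close>: if a positive \<open>a\<close> is no
  atom, two disjoint nonzero elements that can replace it are then at hand.\<close>

definition lattice_atom :: "'a::banach_lattice \<Rightarrow> bool" where
  "lattice_atom a \<longleftrightarrow> 0 < a \<and>
    (\<forall>u v. 0 \<le> u \<longrightarrow> u \<le> a \<longrightarrow> 0 \<le> v \<longrightarrow> v \<le> a \<longrightarrow> inf u v = 0 \<longrightarrow> u = 0 \<or> v = 0)"

lemma sup_inf_disjoint:
  fixes z :: "'a::banach_lattice"
  shows "inf (sup z 0) (sup (- z) 0) = 0"
proof -
  have "sup z 0 = z + sup (- z) 0" by (simp add: add_sup_distrib_left sup.commute)
  then have "inf (sup z 0) (sup (- z) 0) = inf z 0 + sup (- z) 0"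
    by (simp add: add_inf_distrib_right)
  also have "\<dots> = inf z 0 + - inf z 0" by (simp only: neg_inf_eq_sup minus_zero)
  finally show ?thesis by (simp only: add.right_inverse)
qed

text \<open>The largest \<open>l\<close> with \<open>l a \<le> y\<close> works: for \<open>d > 0\<close> the positive and the negative part of
  \<open>y - (l + d) a\<close> are disjoint and the negative part does not vanish, so that the positive part is
  disjoint from the atom \<open>a\<close>.\<close>

lemma lattice_atom_decompose:
  fixes a y :: "'a::banach_lattice"
  assumes a: "lattice_atom a" and y: "0 \<le> y"
  shows "\<exists>l. 0 \<le> l \<and> l *\<^sub>R a \<le> y \<and> inf (y - l *\<^sub>R a) a = 0"
proof -
  have a0: "0 < a" using a by (auto simp: lattice_atom_def)
  define S where "S = {l. 0 \<le> l \<and> l *\<^sub>R a \<le> y}"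
  define l where "l = Sup S"
  have na: "norm a > 0" using a0 by auto
  have bdd: "t \<le> norm y / norm a" if "t \<in> S" for t
  proof -
    have "norm (t *\<^sub>R a) \<le> norm y"
      using that a0 by (intro norm_mono_lat) (auto simp: S_def intro!: scaleR_nonneg_nonneg)
    then show ?thesis using that na by (simp add: S_def field_simps)
  qed
  have S0: "0 \<in> S" using y by (simp add: S_def)
  have bS: "bdd_above S" using bdd by (intro bdd_aboveI[of _ "norm y / norm a"])
  have "closed S"
    unfolding closed_sequential_limits
  proof (intro allI impI, elim conjE)
    fix u t assume u: "\<forall>n. u n \<in> S" and t: "u \<longlonglongrightarrow> t"
    have "t *\<^sub>R a \<le> y"
      by (rule lat_limit_le[of "\<lambda>n. u n *\<^sub>R a"]) (use u t in \<open>auto simp: S_def intro!: tendsto_intros\<close>)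
    moreover have "0 \<le> t" using LIMSEQ_le_const[OF t] u by (auto simp: S_def)
    ultimately show "t \<in> S" by (simp add: S_def)
  qed
  then have lS: "l \<in> S" unfolding l_def using S0 bS by (intro closed_contains_Sup) auto
  define w where "w = inf (y - l *\<^sub>R a) a"
  have w0: "0 \<le> w" using lS a0 by (auto simp: w_def S_def)
  have wle: "w \<le> d *\<^sub>R a" if d: "d > 0" for d
  proof -
    define z where "z = y - (l + d) *\<^sub>R a"
    have "l + d \<notin> S" using d cSup_upper[OF _ bS] unfolding l_def by force
    then have nle: "\<not> (l + d) *\<^sub>R a \<le> y" using lS d by (auto simp: S_def)
    have 1: "inf (sup z 0) a = 0"
    proof (rule ccontr)
      assume n: "inf (sup z 0) a \<noteq> 0"
      \<comment> \<open>Since \<open>y\<close> is positive, the negative part of \<open>z\<close> is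
        at most \<open>(l + d) a\<close>. The factor \<open>t\<close> brings it below
        \<open>a\<close>, where the atom property can be applied to it together with
        \<open>inf (sup z 0) a\<close>.\<close>
      define t where "t = 1 / (l + d)"
      have ld: "l + d > 0" using lS d by (auto simp: S_def)
      have le: "sup (- z) 0 \<le> (l + d) *\<^sub>R a"
        using y a0 ld by (auto simp: z_def intro!: scaleR_nonneg_nonneg)
      define v where "v = t *\<^sub>R sup (- z) 0"
      have v: "0 \<le> v" "v \<le> a"
        using scaleR_left_mono[OF le, of t] ld by (auto simp: v_def t_def intro!: scaleR_nonneg_nonneg)
      have "inf (1 *\<^sub>R sup z 0) v = 0"
        unfolding v_def using ld by (intro inf_scaleR_eq_0_lat sup_inf_disjoint) (auto simp: t_def)
      then have "inf (inf (sup z 0) a) v = 0"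
        using v a0 by (simp add: inf.assoc inf.absorb2)
      with n v a a0 have "v = 0" unfolding lattice_atom_def
        by (metis inf_le2 le_inf_iff less_imp_le sup_ge2)
      then have "sup (- z) 0 = 0" using ld by (simp add: v_def t_def)
      then have "- z \<le> 0" by (metis sup_ge1)
      then show False using nle by (simp add: z_def)
    qed
    \<comment> \<open>By subadditivity of \<open>inf\<close>, the contribution of the positive part
      of \<open>z\<close> vanishes and only \<open>d a\<close> is left; \<open>d\<close> tends to 0
      afterwards.\<close>
    have "y - l *\<^sub>R a = z + d *\<^sub>R a" by (simp add: z_def algebra_simps)
    also have "\<dots> \<le> sup z 0 + d *\<^sub>R a" by simp
    finally have "w \<le> inf a (sup z 0 + d *\<^sub>R a)" unfolding w_def
      by (metis inf.commute inf_mono order_refl)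
    also have "\<dots> \<le> inf a (sup z 0) + inf a (d *\<^sub>R a)"
      using a0 d by (intro inf_add_le_lat) (auto intro!: scaleR_nonneg_nonneg)
    also have "\<dots> \<le> d *\<^sub>R a" using 1 by (simp add: inf.commute)
    finally show ?thesis .
  qed
  have "w \<le> 0"
  proof -
    have "(\<lambda>n. w - (1 / real (Suc n)) *\<^sub>R a) \<longlonglongrightarrow> w - 0 *\<^sub>R a"
      by (intro tendsto_intros LIMSEQ_Suc[OF lim_1_over_n])
    then have "w - 0 *\<^sub>R a \<le> 0"
      by (rule lat_limit_le) (use wle[of "1 / real (Suc _)"] in auto)
    then show ?thesis by simp
  qed
  with w0 have "w = 0" by simp
  with lS show ?thesis by (auto simp: w_def S_def)
qed

text \<open>Multiples of the atoms are split off one after another. The remainder only decreases, so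
  it stays disjoint from the atoms treated before.\<close>

lemma orthogonal_atoms_decompose:
  fixes A :: "'a::banach_lattice set"
  assumes "finite A" "orthogonal_set A" "\<And>a. a \<in> A \<Longrightarrow> lattice_atom a" "0 \<le> y"
  shows "\<exists>y'. 0 \<le> y' \<and> y' \<le> y \<and> y - y' \<in> span A \<and> (\<forall>a\<in>A. inf y' a = 0)"
  using assms
proof (induction A rule: finite_induct)
  case empty
  then show ?case by (intro exI[of _ y]) auto
next
  case (insert a A)
  then obtain y' where y': "0 \<le> y'" "y' \<le> y" "y - y' \<in> span A" "\<forall>b\<in>A. inf y' b = 0"
    by (auto simp: orthogonal_set_def)
  from insert lattice_atom_decompose[OF _ y'(1), of a] obtain l where
    l: "0 \<le> l" "l *\<^sub>R a \<le> y'" "inf (y' - l *\<^sub>R a) a = 0" by auto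
  have a0: "0 < a" and b0: "\<And>b. b \<in> A \<Longrightarrow> 0 < b" using insert by (auto simp: orthogonal_set_def)
  have le: "y' - l *\<^sub>R a \<le> y'" using l a0 by (auto intro: scaleR_nonneg_nonneg)
  show ?case
  proof (intro exI[of _ "y' - l *\<^sub>R a"] conjI ballI)
    show "y' - l *\<^sub>R a \<le> y" using le y' by (metis order_trans)
    have "y - y' \<in> span (insert a A)" "l *\<^sub>R a \<in> span (insert a A)"
      using y'(3) span_mono[of A "insert a A"] by (auto intro: span_scale span_base)
    then have "(y - y') + l *\<^sub>R a \<in> span (insert a A)" by (rule span_add)
    then show "y - (y' - l *\<^sub>R a) \<in> span (insert a A)" by (simp add: algebra_simps)
    fix b assume "b \<in> insert a A"
    then show "inf (y' - l *\<^sub>R a) b = 0"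
    proof
      assume b: "b \<in> A"
      have "inf (y' - l *\<^sub>R a) b \<le> inf y' b" using le by (metis inf_mono order_refl)
      with y' b b0[OF b] l show ?thesis by (intro antisym) auto
    qed (use l in simp)
  qed (use l in auto)
qed

text \<open>If all elements of \<open>A\<close> are atoms, some positive element is disjoint from
  all of them and can be added: otherwise the remainder in \<open>orthogonal_atoms_decompose\<close>
  would always be 0 and \<open>A\<close> would span the space. If some \<open>a\<close> is not an
  atom, it is replaced by two disjoint nonzero elements below it.\<close>

lemma infinite_dimensional_orthogonal_set:
  assumes "infinite_dimensional (scaleR :: real \<Rightarrow> 'a::banach_lattice \<Rightarrow> 'a)"
  shows "\<exists>A :: 'a set. finite A \<and> orthogonal_set A \<and> card A = n"
proof (induction n)
  case 0
  show ?case by (intro exI[of _ "{}"]) (auto simp: orthogonal_set_def)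
next
  case (Suc n)
  then obtain A :: "'a set" where A: "finite A" "orthogonal_set A" "card A = n" by auto
  have pos: "0 < a" if "a \<in> A" for a using A that by (auto simp: orthogonal_set_def)
  have dis: "inf a b = 0" if "a \<in> A" "b \<in> A" "a \<noteq> b" for a b
    using A that by (auto simp: orthogonal_set_def)
  show ?case
  proof (cases "\<forall>a\<in>A. lattice_atom a")
    case True
    have ex: "\<exists>y. 0 < y \<and> (\<forall>a\<in>A. inf y a = 0)"
    proof (rule ccontr)
      assume no: "\<not> ?thesis"
      have pos_span: "y \<in> span A" if "0 \<le> y" for y
      proof -
        obtain y' where y': "0 \<le> y'" "y' \<le> y" "y - y' \<in> span A" "\<forall>a\<in>A. inf y' a = 0"
          using orthogonal_atoms_decompose[OF A(1) A(2), of y] True \<open>0 \<le> y\<close> by metis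
        then have "y' = 0" using no by (metis order_le_less)
        then show ?thesis using y' by simp
      qed
      have "y \<in> span A" for y
      proof -
        have "pprt y - (- nprt y) \<in> span A" by (intro span_diff pos_span) auto
        then show ?thesis using prts[of y] by simp
      qed
      then have "span A = UNIV" by auto
      with A(1) assms show False
        unfolding infinite_dimensional_def span_raw_def by blast
    qed
    then obtain y where y: "0 < y" "\<forall>a\<in>A. inf y a = 0" by blast
    then have "y \<notin> A" by force
    then show ?thesis
      using A y by (intro exI[of _ "insert y A"]) (auto simp: orthogonal_set_def inf.commute)
  next
    case False
    then obtain a u v where a: "a \<in> A" and uv: "0 \<le> u" "u \<le> a" "0 \<le> v" "v \<le> a" "inf u v = 0"
      "u \<noteq> 0" "v \<noteq> 0"
      using pos by (auto simp: lattice_atom_def)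
    have orth: "inf w b = 0" if "0 \<le> w" "w \<le> a" "b \<in> A - {a}" for w b
    proof -
      have "inf w b \<le> inf a b" using that by (metis inf_mono order_refl)
      also have "\<dots> = 0" using dis[OF a, of b] that by auto
      finally show ?thesis using that pos[of b] by (intro antisym) auto
    qed
    \<comment> \<open>An element of \<open>A - {a}\<close> below \<open>a\<close> would be disjoint
      from itself. Hence the replacement raises the cardinality by exactly one.\<close>
    have not_in: "w \<notin> A - {a}" if "0 \<le> w" "w \<le> a" "w \<noteq> 0" for w
      using orth[of w w] that by auto
    have neq: "u \<noteq> v" using uv by auto
    show ?thesis
    proof (intro exI[of _ "insert u (insert v (A - {a}))"] conjI)
      show "card (insert u (insert v (A - {a}))) = Suc n"
        using A a neq not_in uv card_Suc_Diff1[OF A(1) a] by auto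
      show "orthogonal_set (insert u (insert v (A - {a})))"
        unfolding orthogonal_set_def
        using uv orth[OF uv(1,2)] orth[OF uv(3,4)] dis pos by (auto simp: inf.commute)
    qed (use A in auto)
  qed
qed

lemma infinite_dimensional_disjoint_pos:
  assumes "infinite_dimensional (scaleR :: real \<Rightarrow> 'a::banach_lattice \<Rightarrow> 'a)" and "finite I"
  shows "\<exists>x :: 'i \<Rightarrow> 'a. disjoint_pos I x \<and> (\<forall>i\<in>I. norm (x i) = 1)"
proof -
  obtain A :: "'a set" where A: "finite A" "orthogonal_set A" "card A = card I"
    using infinite_dimensional_orthogonal_set[OF assms(1)] by blast
  then obtain h where h: "bij_betw h I A" using assms(2) by (metis finite_same_card_bij)
  have hA: "h i \<in> A" if "i \<in> I" for i using h that by (auto simp: bij_betw_def)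
  then have pos: "0 < h i" if "i \<in> I" for i using A that by (auto simp: orthogonal_set_def)
  have "inf (h i) (h j) = 0" if "i \<in> I" "j \<in> I" "i \<noteq> j" for i j
    using A(2) hA[OF that(1)] hA[OF that(2)] that h unfolding orthogonal_set_def
    by (metis bij_betw_imp_inj_on inj_onD)
  then have "disjoint_pos I h" using pos by (auto simp: disjoint_pos_def less_imp_le)
  then have "disjoint_pos I (\<lambda>i. inverse (norm (h i)) *\<^sub>R h i)" by (rule disjoint_pos_scaleR) auto
  moreover have "norm (inverse (norm (h i)) *\<^sub>R h i) = 1" if "i \<in> I" for i
    using pos[OF that] by auto
  ultimately show ?thesis by blast
qed

section \<open>Averages of simple functions and randomised sums\<close>

text \<open>The integral is defined by \<open>THE\<close>, so uniqueness is the point: for every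
  admissible sequence \<open>u\<close>, the integrals of \<open>f\<close> and \<open>u i\<close>
  differ in norm by at most the integral of \<open>norm (f s - u i s)\<close>, which tends to
  0.\<close>

lemma Bochner_integral_simple:
  assumes f: "Bochner_Integration.simple_bochner_integrable M f"
  shows "Bochner_integral M f = Bochner_Integration.simple_bochner_integral M f"
  unfolding Bochner_integral_def
proof (rule the_equality)
  let ?I = "Bochner_Integration.simple_bochner_integral M"
  have sf: "simple_function M f" using f by (auto elim: Bochner_Integration.simple_bochner_integrable.cases)
  show "has_Bochner_integral M f (?I f)"
    unfolding has_Bochner_integral_def strongly_measurable_def
    using f sf by (intro conjI exI[of _ "\<lambda>_. f"]) auto
  fix J assume "has_Bochner_integral M f J"
  then obtain u where u: "\<And>i. Bochner_Integration.simple_bochner_integrable M (u i)"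
    and lim: "(\<lambda>i. \<integral>\<^sup>+s. ennreal (norm (f s - u i s)) \<partial>M) \<longlonglongrightarrow> 0"
    and J: "(\<lambda>i. ?I (u i)) \<longlonglongrightarrow> J"
    by (auto simp: has_Bochner_integral_def)
  have le: "ennreal (norm (?I f - ?I (u i))) \<le> (\<integral>\<^sup>+s. ennreal (norm (f s - u i s)) \<partial>M)" for i
  proof -
    have d: "Bochner_Integration.simple_bochner_integrable M (\<lambda>s. f s - u i s)"
      by (rule Bochner_Integration.simple_bochner_integrable_compose2[of "(-)", OF _ f u]) simp
    have n: "Bochner_Integration.simple_bochner_integrable M (\<lambda>s. norm (f s - u i s))"
      by (rule Bochner_Integration.simple_bochner_integrable_compose2[of "\<lambda>x y. norm (x - y)", OF _ f u]) simp
    have "?I f - ?I (u i) = ?I (\<lambda>s. f s - u i s)"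
      by (rule Bochner_Integration.simple_bochner_integral_diff[OF f u, symmetric])
    then have "ennreal (norm (?I f - ?I (u i)))
        \<le> ennreal (Bochner_Integration.simple_bochner_integral M (\<lambda>s. norm (f s - u i s)))"
      using Bochner_Integration.simple_bochner_integral_norm_bound[OF d] by (simp add: ennreal_leI)
    also have "\<dots> = (\<integral>\<^sup>+s. ennreal (norm (f s - u i s)) \<partial>M)"
      by (rule Bochner_Integration.simple_bochner_integral_eq_nn_integral[OF n]) simp
    finally show ?thesis .
  qed
  have "(\<lambda>i. ennreal (norm (?I f - ?I (u i)))) \<longlonglongrightarrow> 0"
    by (rule tendsto_sandwich[OF _ _ tendsto_const lim]) (use le in auto)
  moreover have "(\<lambda>i. ennreal (norm (?I f - ?I (u i)))) \<longlonglongrightarrow> ennreal (norm (?I f - J))"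
    by (intro tendsto_intros J)
  ultimately have "ennreal (norm (?I f - J)) = 0" by (rule LIMSEQ_unique[symmetric])
  then show "J = ?I f" by simp
qed

text \<open>Reduces vector-valued averages to scalar integrals; both test functions of the proof
  have this form.\<close>

lemma average_sum_scaleR:
  fixes g :: "'i \<Rightarrow> 's::euclidean_space \<Rightarrow> real" and v :: "'i \<Rightarrow> 'x::real_normed_vector"
  assumes Q: "Q \<in> lmeasurable" and g: "\<And>i. i \<in> I \<Longrightarrow> simple_function (lebesgue_on Q) (g i)"
    and I: "finite I"
  shows "average Q (\<lambda>t. \<Sum>i\<in>I. g i t *\<^sub>R v i)
    = (\<Sum>i\<in>I. (integral\<^sup>L (lebesgue_on Q) (g i) / measure lebesgue Q) *\<^sub>R v i)"
proof -
  let ?M = "lebesgue_on Q"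
  interpret finite_measure ?M using Q by (rule finite_measure_lebesgue_on)
  have integrable: "Bochner_Integration.simple_bochner_integrable ?M h" if "simple_function ?M h"
    for h :: "'s \<Rightarrow> 'y::real_vector"
    using that by (intro Bochner_Integration.simple_bochner_integrable.intros) auto
  have "Bochner_Integration.simple_bochner_integral ?M (\<lambda>t. \<Sum>i\<in>I. g i t *\<^sub>R v i)
    = (\<Sum>i\<in>I. integral\<^sup>L ?M (g i) *\<^sub>R v i)"
    using I g
  proof (induction I rule: finite_induct)
    case empty
    then show ?case by (auto simp: Bochner_Integration.simple_bochner_integral_def intro!: sum.neutral)
  next
    case (insert i I)
    have gi: "simple_function ?M (g i)" by (rule insert.prems) simp
    have 1: "simple_function ?M (\<lambda>t. g j t *\<^sub>R v j)" if "j \<in> insert i I" for j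
      by (rule simple_function_compose1[where g = "\<lambda>r. r *\<^sub>R v j"]) (rule insert.prems[OF that])
    have "linear (\<lambda>r. r *\<^sub>R v i)" by (auto intro!: linearI simp: algebra_simps)
    from Bochner_Integration.simple_bochner_integral_linear[OF this integrable[OF gi]]
    have 2: "Bochner_Integration.simple_bochner_integral ?M (\<lambda>t. g i t *\<^sub>R v i) = integral\<^sup>L ?M (g i) *\<^sub>R v i"
      by (simp add: Bochner_Integration.simple_bochner_integrable_eq_integral[OF integrable[OF gi]])
    have 3: "Bochner_Integration.simple_bochner_integral ?M (\<lambda>t. g i t *\<^sub>R v i + (\<Sum>i\<in>I. g i t *\<^sub>R v i))
      = Bochner_Integration.simple_bochner_integral ?M (\<lambda>t. g i t *\<^sub>R v i)
        + Bochner_Integration.simple_bochner_integral ?M (\<lambda>t. \<Sum>i\<in>I. g i t *\<^sub>R v i)"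
      by (intro Bochner_Integration.simple_bochner_integral_add integrable simple_function_sum 1) auto
    have 4: "Bochner_Integration.simple_bochner_integral ?M (\<lambda>t. \<Sum>i\<in>I. g i t *\<^sub>R v i)
      = (\<Sum>i\<in>I. integral\<^sup>L ?M (g i) *\<^sub>R v i)"
      by (rule insert.IH, rule insert.prems) simp
    show ?case using insert.hyps by (simp add: 2 3 4)
  qed
  moreover have "simple_function ?M (\<lambda>t. \<Sum>i\<in>I. g i t *\<^sub>R v i)"
    by (intro simple_function_sum simple_function_compose1[where g = "\<lambda>r. r *\<^sub>R v _"] g)
  ultimately show ?thesis
    by (simp add: average_def Bochner_integral_simple integrable scaleR_sum_right)
qed

section \<open>The uniform distribution on the unit sphere of the scalar field\<close>

lemma sets_uniform_sphere [measurable_cong]: "sets (uniform_sphere :: 'k::euclidean_space measure) = sets borel"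
  by (simp add: uniform_sphere_def)

lemma sgn_borel_measurable_euclidean: "(sgn :: 'k::euclidean_space \<Rightarrow> 'k) \<in> borel_measurable borel"
  unfolding sgn_div_norm by measurable

lemma emeasure_unit_ball:
  "emeasure lborel (ball 0 1 :: 'k::euclidean_space set) \<noteq> 0"
  "emeasure lborel (ball 0 1 :: 'k::euclidean_space set) < \<infinity>"
proof -
  show "emeasure lborel (ball 0 1 :: 'k set) \<noteq> 0"
    using content_ball_pos[of 1 "0::'k"] unfolding measure_def by fastforce
  show "emeasure lborel (ball 0 1 :: 'k set) < \<infinity>"
    by (rule emeasure_lborel_ball_finite)
qed

lemma prob_space_uniform_sphere: "prob_space (uniform_sphere :: 'k::euclidean_space measure)"
  unfolding uniform_sphere_def
  using emeasure_unit_ball[where 'k = 'k]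
  by (intro prob_space.prob_space_distr prob_space_uniform_measure)
    (auto simp: sgn_borel_measurable_euclidean measurable_cong_sets[OF sets_uniform_measure refl])

lemma AE_uniform_sphere: "AE z in (uniform_sphere :: 'k::euclidean_space measure). norm z = 1"
proof -
  have "AE z in lborel. z \<noteq> (0::'k)" by (rule AE_lborel_singleton)
  then have "AE z in uniform_measure lborel (ball 0 1 :: 'k set). norm (sgn z) = 1"
    by (intro AE_uniform_measureI) (auto simp: norm_sgn)
  then show ?thesis
    unfolding uniform_sphere_def
    by (subst AE_distr_iff)
      (auto simp: sgn_borel_measurable_euclidean measurable_cong_sets[OF sets_uniform_measure refl])
qed

text \<open>The real and the complex case at once: \<open>'a\<close> is the real Banach lattice, \<open>J\<close> embeds it into
  \<open>'a\<close> itself or into its complexification \<open>'x\<close>, and \<open>part b\<close> is the component of a vector of \<open>'x\<close> along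
  the basis element \<open>b\<close> of the scalar field (the vector itself, or its real or imaginary part).\<close>

locale lattice_scalars =
  fixes scl :: "'k::{real_normed_field,euclidean_space} \<Rightarrow> 'x \<Rightarrow> 'x::{real_normed_vector,order,abs}"
    and J :: "'a::banach_lattice \<Rightarrow> 'x"
    and modulus :: "'x \<Rightarrow> 'a"
    and part :: "'k \<Rightarrow> 'x \<Rightarrow> 'a"
  assumes scl_add_left: "scl (a + b) v = scl a v + scl b v"
    and scl_add_right: "scl a (v + w) = scl a v + scl a w"
    and scl_scl: "scl a (scl b v) = scl (a * b) v"
    and scl_of_real: "scl (of_real r) v = r *\<^sub>R v"
    and norm_scl: "norm (scl a v) = norm a * norm v"
    and linear_J: "linear J"
    and abs_J: "\<bar>J x\<bar> = J \<bar>x\<bar>"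
    and J_le_iff: "J x \<le> J y \<longleftrightarrow> x \<le> y"
    and J_upper: "J x \<le> w \<Longrightarrow> \<exists>y. w = J y"
    and norm_modulus: "norm (modulus v) = norm v"
    and modulus_triangle: "modulus (v + w) \<le> modulus v + modulus w"
    and modulus_scl_J: "modulus (scl a (J x)) = norm a *\<^sub>R \<bar>x\<bar>"
    and part_add: "part b (v + w) = part b v + part b w"
    and part_scl_J: "b \<in> Basis \<Longrightarrow> part b (scl a (J x)) = (a \<bullet> b) *\<^sub>R x"
    and abs_part_le: "b \<in> Basis \<Longrightarrow> \<bar>part b v\<bar> \<le> modulus v"
begin

section \<open>Norms of scalar combinations and of randomised sums\<close>

lemma scl_sum_left: "scl (sum a I) v = (\<Sum>i\<in>I. scl (a i) v)"
proof -
  have 0: "scl 0 v = 0" using scl_of_real[of 0 v] by simp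
  show ?thesis by (induction I rule: infinite_finite_induct) (auto simp: 0 scl_add_left)
qed

lemma scl_sum_right: "scl a (sum v I) = (\<Sum>i\<in>I. scl a (v i))"
proof -
  have 0: "scl a 0 = 0" using norm_scl[of a 0] by simp
  show ?thesis by (induction I rule: infinite_finite_induct) (auto simp: 0 scl_add_right)
qed

lemma scl_scaleR: "scl a (r *\<^sub>R v) = scl (r *\<^sub>R a) v"
  by (metis mult.commute scaleR_conv_of_real scl_of_real scl_scl)

lemma bounded_linear_scl: "bounded_linear (\<lambda>a. scl a v)"
proof
  fix r a show "scl (r *\<^sub>R a) v = r *\<^sub>R scl a v"
    by (metis scaleR_conv_of_real scl_of_real scl_scl)
qed (auto simp: scl_add_left norm_scl intro: exI[of _ "norm v"])

lemma norm_J: "norm (J x) = norm x"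
  using norm_modulus[of "scl 1 (J x)"] by (simp add: modulus_scl_J) (metis mult_1 norm_one norm_scl)

lemma modulus_nonneg: "0 \<le> modulus v"
proof -
  obtain b :: 'k where "b \<in> Basis" using nonempty_Basis by blast
  then show ?thesis using abs_part_le[of b v] abs_ge_zero order_trans by blast
qed

lemma modulus_sum_le: "modulus (sum v I) \<le> (\<Sum>i\<in>I. modulus (v i))"
proof -
  have "modulus 0 = 0" using norm_modulus[of 0] by simp
  then show ?thesis
    by (induction I rule: infinite_finite_induct)
      (auto intro: order_trans[OF modulus_triangle] add_left_mono)
qed

lemma part_sum: "part b (sum v I) = (\<Sum>i\<in>I. part b (v i))"
proof -
  have "part b 0 = 0" using part_add[of b 0 0] by simp
  then show ?thesis by (induction I rule: infinite_finite_induct) (auto simp: part_add)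
qed

text \<open>By the triangle inequality for the modulus, absolute values of the coefficients suffice
  for an upper bound, which is therefore uniform in the unimodular scalars.\<close>

lemma norm_sum_scl_J_le:
  assumes "\<And>i. i \<in> I \<Longrightarrow> 0 \<le> x i" and "\<And>i. i \<in> I \<Longrightarrow> norm (c i) \<le> m i"
  shows "norm (\<Sum>i\<in>I. scl (c i) (J (x i))) \<le> norm (\<Sum>i\<in>I. m i *\<^sub>R x i)"
proof -
  have "modulus (\<Sum>i\<in>I. scl (c i) (J (x i))) \<le> (\<Sum>i\<in>I. norm (c i) *\<^sub>R \<bar>x i\<bar>)"
    using modulus_sum_le[of "\<lambda>i. scl (c i) (J (x i))" I] by (simp add: modulus_scl_J)
  also have "\<dots> \<le> (\<Sum>i\<in>I. m i *\<^sub>R x i)"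
    using assms by (intro sum_mono) (auto simp: abs_of_nonneg intro!: scaleR_right_mono)
  finally have "norm (modulus (\<Sum>i\<in>I. scl (c i) (J (x i)))) \<le> norm (\<Sum>i\<in>I. m i *\<^sub>R x i)"
    by (rule norm_mono_lat[OF modulus_nonneg])
  then show ?thesis by (simp add: norm_modulus)
qed

text \<open>The component along \<open>b\<close> turns the combination into one with real
  coefficients, to which \<open>disjoint_pos_abs_sum_ge\<close> applies.\<close>

lemma norm_sum_scl_J_ge:
  assumes "finite I" "disjoint_pos I x" "j \<in> I" "b \<in> Basis"
  shows "\<bar>c j \<bullet> b\<bar> * norm (x j) \<le> norm (\<Sum>i\<in>I. scl (c i) (J (x i)))"
proof -
  let ?v = "\<Sum>i\<in>I. scl (c i) (J (x i))"
  have x: "0 \<le> x j" using assms by (auto simp: disjoint_pos_def)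
  have "\<bar>c j \<bullet> b\<bar> *\<^sub>R x j \<le> \<bar>part b ?v\<bar>"
    using disjoint_pos_abs_sum_ge[OF assms(1-3), of "\<lambda>i. c i \<bullet> b"]
    by (simp add: part_sum part_scl_J assms(4))
  also have "\<dots> \<le> modulus ?v" by (rule abs_part_le[OF assms(4)])
  finally have "norm (\<bar>c j \<bullet> b\<bar> *\<^sub>R x j) \<le> norm (modulus ?v)"
    using x by (intro norm_mono_lat) (auto intro: scaleR_nonneg_nonneg)
  then show ?thesis by (simp add: norm_modulus)
qed

text \<open>The target space may be nonseparable, where sums of Borel functions need not be Borel.
  Hence the scalars are approximated by simple functions: the approximating sums are simple again,
  and only their norms have to converge.\<close>

lemma borel_measurable_norm_sum_scl:
  assumes F: "F \<subseteq> D"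
  shows "(\<lambda>\<epsilon>. norm (\<Sum>Q\<in>F. scl (\<epsilon> Q) (v Q)))
    \<in> borel_measurable (\<Pi>\<^sub>M Q\<in>D. (uniform_sphere :: 'k measure))" (is "_ \<in> borel_measurable ?M")
proof -
  have "\<exists>G. (\<forall>i. simple_function ?M (G i)) \<and> (\<forall>\<epsilon>\<in>space ?M. (\<lambda>i. G i \<epsilon>) \<longlonglongrightarrow> \<epsilon> Q)"
    if "Q \<in> F" for Q
  proof -
    have "Q \<in> D" using that F by auto
    then have "(\<lambda>\<epsilon>. \<epsilon> Q) \<in> ?M \<rightarrow>\<^sub>M uniform_sphere" by measurable
    then have "(\<lambda>\<epsilon>. \<epsilon> Q) \<in> borel_measurable ?M"
      using measurable_cong_sets[OF refl sets_uniform_sphere] by blast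
    from borel_measurable_implies_sequence_metric[OF this, of 0] show ?thesis by blast
  qed
  then obtain G where G: "\<And>Q i. Q \<in> F \<Longrightarrow> simple_function ?M (G Q i)"
    "\<And>Q \<epsilon>. Q \<in> F \<Longrightarrow> \<epsilon> \<in> space ?M \<Longrightarrow> (\<lambda>i. G Q i \<epsilon>) \<longlonglongrightarrow> \<epsilon> Q"
    by metis
  show ?thesis
  proof (rule borel_measurable_LIMSEQ_real)
    fix \<epsilon> assume "\<epsilon> \<in> space ?M"
    then show "(\<lambda>i. norm (\<Sum>Q\<in>F. scl (G Q i \<epsilon>) (v Q))) \<longlonglongrightarrow> norm (\<Sum>Q\<in>F. scl (\<epsilon> Q) (v Q))"
      by (intro tendsto_norm tendsto_sum bounded_linear.tendsto[OF bounded_linear_scl] G)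
  next
    fix i
    have "simple_function ?M (\<lambda>\<epsilon>. \<Sum>Q\<in>F. scl (G Q i \<epsilon>) (v Q))"
      by (intro simple_function_sum simple_function_compose1[where g = "\<lambda>a. scl a (v _)"] G)
    then show "(\<lambda>\<epsilon>. norm (\<Sum>Q\<in>F. scl (G Q i \<epsilon>) (v Q))) \<in> borel_measurable ?M"
      by (rule borel_measurable_simple_function[OF simple_function_compose1[where g = norm]])
  qed
qed

text \<open>Bounds for all unimodular scalars pass to the \<open>L^2\<close> norm, because the
  finitely many \<open>\<epsilon> Q\<close> are almost surely unimodular and the product is a
  probability space.\<close>

lemma
  assumes F: "finite F" "F \<subseteq> D"
  shows randomized_sum_L2_ge: "0 \<le> B \<Longrightarrow>
      (\<And>\<epsilon>. (\<And>Q. Q \<in> F \<Longrightarrow> norm (\<epsilon> Q) = 1) \<Longrightarrow> B \<le> norm (\<Sum>Q\<in>F. scl (\<epsilon> Q) (v Q))) \<Longrightarrow>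
      B \<le> sqrt (\<integral>\<epsilon>. (norm (\<Sum>Q\<in>F. scl (\<epsilon> Q) (v Q)))\<^sup>2 \<partial>(\<Pi>\<^sub>M Q\<in>D. (uniform_sphere :: 'k measure)))"
    and randomized_sum_L2_le: "0 \<le> B \<Longrightarrow>
      (\<And>\<epsilon>. (\<And>Q. Q \<in> F \<Longrightarrow> norm (\<epsilon> Q) = 1) \<Longrightarrow> norm (\<Sum>Q\<in>F. scl (\<epsilon> Q) (v Q)) \<le> B) \<Longrightarrow>
      sqrt (\<integral>\<epsilon>. (norm (\<Sum>Q\<in>F. scl (\<epsilon> Q) (v Q)))\<^sup>2 \<partial>(\<Pi>\<^sub>M Q\<in>D. (uniform_sphere :: 'k measure))) \<le> B"
proof -
  let ?M = "\<Pi>\<^sub>M Q\<in>D. (uniform_sphere :: 'k measure)"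
  let ?f = "\<lambda>\<epsilon>. (norm (\<Sum>Q\<in>F. scl (\<epsilon> Q) (v Q)))\<^sup>2"
  interpret prob_space ?M by (intro prob_space_PiM prob_space_uniform_sphere)
  have "AE \<epsilon> in ?M. \<forall>Q\<in>F. norm (\<epsilon> Q) = 1"
    using F by (intro AE_finite_allI AE_PiM_component prob_space_uniform_sphere AE_uniform_sphere) auto
  then have ae: "AE \<epsilon> in ?M. P \<epsilon>" if "\<And>\<epsilon>. (\<And>Q. Q \<in> F \<Longrightarrow> norm (\<epsilon> Q) = 1) \<Longrightarrow> P \<epsilon>" for P
    by (rule eventually_mono) (use that in auto)
  \<comment> \<open>Integrability has to be secured: the integral of a non-integrable function is 0
    by convention, which would spoil the lower bound.\<close>
  have "AE \<epsilon> in ?M. norm (?f \<epsilon>) \<le> (\<Sum>Q\<in>F. norm (v Q))\<^sup>2"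
  proof (rule ae)
    fix \<epsilon> :: "'b \<Rightarrow> 'k" assume \<epsilon>: "\<And>Q. Q \<in> F \<Longrightarrow> norm (\<epsilon> Q) = 1"
    have "norm (\<Sum>Q\<in>F. scl (\<epsilon> Q) (v Q)) \<le> (\<Sum>Q\<in>F. norm (scl (\<epsilon> Q) (v Q)))" by (rule norm_sum)
    also have "\<dots> = (\<Sum>Q\<in>F. norm (v Q))" using \<epsilon> by (simp add: norm_scl)
    finally show "norm (?f \<epsilon>) \<le> (\<Sum>Q\<in>F. norm (v Q))\<^sup>2" by (simp add: power_mono)
  qed
  then have int: "integrable ?M ?f"
    by (rule integrable_const_bound) (intro borel_measurable_power borel_measurable_norm_sum_scl F)
  {
    assume "0 \<le> B" and B: "\<And>\<epsilon>. (\<And>Q. Q \<in> F \<Longrightarrow> norm (\<epsilon> Q) = 1) \<Longrightarrow> B \<le> norm (\<Sum>Q\<in>F. scl (\<epsilon> Q) (v Q))"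
    have "B\<^sup>2 \<le> (\<integral>\<epsilon>. ?f \<epsilon> \<partial>?M)"
      by (intro integral_ge_const int ae power_mono B) (use \<open>0 \<le> B\<close> in auto)
    then show "B \<le> sqrt (\<integral>\<epsilon>. ?f \<epsilon> \<partial>?M)" by (rule real_le_rsqrt)
  }
  {
    assume "0 \<le> B" and B: "\<And>\<epsilon>. (\<And>Q. Q \<in> F \<Longrightarrow> norm (\<epsilon> Q) = 1) \<Longrightarrow> norm (\<Sum>Q\<in>F. scl (\<epsilon> Q) (v Q)) \<le> B"
    have "(\<integral>\<epsilon>. ?f \<epsilon> \<partial>?M) \<le> B\<^sup>2"
      by (intro integral_le_const int ae power_mono B) auto
    then show "sqrt (\<integral>\<epsilon>. ?f \<epsilon> \<partial>?M) \<le> B" using \<open>0 \<le> B\<close> by (simp add: real_le_lsqrt) 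
  }
qed

text \<open>The supremum is tested with equal weights \<open>1 / sqrt (card F)\<close> on
  \<open>F\<close>, whose squares add up to 1.\<close>

lemma rademacher_maximal_ge:
  fixes f :: "'s::euclidean_space \<Rightarrow> 'x"
  assumes F: "finite F" "F \<noteq> {}" "\<And>Q. Q \<in> F \<Longrightarrow> Q \<in> \<D> \<and> s \<in> Q" and B: "0 \<le> B"
    and ge: "\<And>\<epsilon> :: 's set \<Rightarrow> 'k. (\<And>Q. Q \<in> F \<Longrightarrow> norm (\<epsilon> Q) = 1) \<Longrightarrow>
      B \<le> norm (\<Sum>Q\<in>F. scl (\<epsilon> Q) (average Q f)) / sqrt (card F)"
  shows "ennreal B \<le> rademacher_maximal scl \<D> f s"
proof -
  define l where "l = 1 / sqrt (card F)"
  define c where "c Q = (if Q \<in> F then of_real l else (0::'k))" for Q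
  have l: "l > 0" using F by (simp add: l_def card_gt_0_iff)
  have sets: "{Q \<in> \<D>. c Q \<noteq> 0} = F" "{Q \<in> \<D>. s \<in> Q \<and> c Q \<noteq> 0} = F"
    using F l by (auto simp: c_def)
  have "(\<Sum>Q\<in>F. (norm (c Q))\<^sup>2) = 1"
    using F by (simp add: c_def l_def norm_divide power_divide)
  then have c: "finite {Q \<in> \<D>. c Q \<noteq> 0} \<and> (\<Sum>Q\<in>{Q \<in> \<D>. c Q \<noteq> 0}. (norm (c Q))\<^sup>2) \<le> 1"
    using F by (simp add: sets)
  have "B \<le> norm (\<Sum>Q\<in>F. scl (\<epsilon> Q) (scl (c Q) (average Q f)))"
    if "\<And>Q. Q \<in> F \<Longrightarrow> norm (\<epsilon> Q) = 1" for \<epsilon> :: "'s set \<Rightarrow> 'k"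
  proof -
    have "(\<Sum>Q\<in>F. scl (\<epsilon> Q) (scl (c Q) (average Q f))) = scl (of_real l) (\<Sum>Q\<in>F. scl (\<epsilon> Q) (average Q f))"
      by (simp add: scl_sum_right scl_scl c_def mult.commute)
    then show ?thesis using ge[of \<epsilon>, OF that] l by (simp add: norm_scl l_def norm_divide)
  qed
  then have "B \<le> sqrt (\<integral>\<epsilon>. (norm (\<Sum>Q\<in>F. scl (\<epsilon> Q) (scl (c Q) (average Q f))))\<^sup>2
      \<partial>(\<Pi>\<^sub>M Q\<in>\<D>. (uniform_sphere :: 'k measure)))"
    using F B by (intro randomized_sum_L2_ge) auto
  then show ?thesis
    unfolding rademacher_maximal_def using c
    by (intro SUP_upper2[of c]) (auto simp: sets intro: ennreal_leI)
qed

lemma rademacher_maximal_le: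
  fixes f :: "'s::euclidean_space \<Rightarrow> 'x"
  assumes B: "0 \<le> B"
    and le: "\<And>F c (\<epsilon> :: 's set \<Rightarrow> 'k). finite F \<Longrightarrow> (\<And>Q. Q \<in> F \<Longrightarrow> Q \<in> \<D> \<and> s \<in> Q) \<Longrightarrow>
      (\<Sum>Q\<in>F. (norm (c Q))\<^sup>2) \<le> 1 \<Longrightarrow> (\<And>Q. Q \<in> F \<Longrightarrow> norm (\<epsilon> Q) = 1) \<Longrightarrow>
      norm (\<Sum>Q\<in>F. scl (\<epsilon> Q) (scl (c Q) (average Q f))) \<le> B"
  shows "rademacher_maximal scl \<D> f s \<le> ennreal B"
  unfolding rademacher_maximal_def
proof (rule SUP_least)
  fix c :: "'s set \<Rightarrow> 'k"
  assume "c \<in> {c. finite {Q \<in> \<D>. c Q \<noteq> 0} \<and> (\<Sum>Q\<in>{Q \<in> \<D>. c Q \<noteq> 0}. (norm (c Q))\<^sup>2) \<le> 1}"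
  then have fin: "finite {Q \<in> \<D>. c Q \<noteq> 0}" and c: "(\<Sum>Q\<in>{Q \<in> \<D>. c Q \<noteq> 0}. (norm (c Q))\<^sup>2) \<le> 1"
    by auto
  let ?F = "{Q \<in> \<D>. s \<in> Q \<and> c Q \<noteq> 0}"
  have F: "finite ?F" by (rule finite_subset[OF _ fin]) auto
  have "(\<Sum>Q\<in>?F. (norm (c Q))\<^sup>2) \<le> (\<Sum>Q\<in>{Q \<in> \<D>. c Q \<noteq> 0}. (norm (c Q))\<^sup>2)"
    by (intro sum_mono2 fin) auto
  with c have c': "(\<Sum>Q\<in>?F. (norm (c Q))\<^sup>2) \<le> 1" by simp
  have "norm (\<Sum>Q\<in>?F. scl (\<epsilon> Q) (scl (c Q) (average Q f))) \<le> B"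
    if "\<And>Q. Q \<in> ?F \<Longrightarrow> norm (\<epsilon> Q) = 1" for \<epsilon> :: "'s set \<Rightarrow> 'k"
    by (rule le[where F = ?F and c = c and \<epsilon> = \<epsilon>, OF F _ c' that]) auto
  then have "sqrt (\<integral>\<epsilon>. (norm (\<Sum>Q\<in>?F. scl (\<epsilon> Q) (scl (c Q) (average Q f))))\<^sup>2
      \<partial>(\<Pi>\<^sub>M Q\<in>\<D>. (uniform_sphere :: 'k measure))) \<le> B"
    by (intro randomized_sum_L2_le[where F = ?F and v = "\<lambda>Q. scl (c Q) (average Q f)", OF F _ B]) auto
  then show "ennreal (sqrt (\<integral>\<epsilon>. (norm (\<Sum>Q\<in>?F. scl (\<epsilon> Q) (scl (c Q) (average Q f))))\<^sup>2
      \<partial>(\<Pi>\<^sub>M Q\<in>\<D>. (uniform_sphere :: 'k measure)))) \<le> ennreal B"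
    by (rule ennreal_leI)
qed

end

section \<open>Failure of the RMF property\<close>

text \<open>Only every second dyadic level is used: then an interval is a quarter, not a half, of the
  next larger one, so a function that equals a sign on the remaining three quarters has an average of
  that sign and of modulus at least 1/2.\<close>

definition quaternary_index :: "nat \<Rightarrow> real \<Rightarrow> nat" where
  "quaternary_index k u = nat \<lfloor>4 ^ k * u\<rfloor>"

definition quaternary_interval :: "nat \<Rightarrow> nat \<Rightarrow> real set" where
  "quaternary_interval k m = {real m / 4 ^ k ..< real (Suc m) / 4 ^ k}"

text \<open>The sign of \<open>u\<close> is stated separately because \<open>nat\<close> also sends
  negative floors to 0.\<close>

lemma mem_quaternary_interval:
  "u \<in> quaternary_interval k m \<longleftrightarrow> 0 \<le> u \<and> quaternary_index k u = m"
proof -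
  have "u \<in> quaternary_interval k m \<longleftrightarrow> real m \<le> 4 ^ k * u \<and> 4 ^ k * u < real m + 1"
    by (simp add: quaternary_interval_def field_simps)
  also have "\<dots> \<longleftrightarrow> \<lfloor>4 ^ k * u\<rfloor> = int m"
    by (simp add: floor_eq_iff)
  also have "\<dots> \<longleftrightarrow> 0 \<le> u \<and> quaternary_index k u = m"
  proof -
    have "0 \<le> \<lfloor>4 ^ k * u\<rfloor> \<longleftrightarrow> 0 \<le> u"
      using mult_le_cancel_left_pos[of "4 ^ k" 0 u] by simp
    then show ?thesis unfolding quaternary_index_def by linarith
  qed
  finally show ?thesis .
qed

lemma quaternary_index_less: "0 \<le> u \<Longrightarrow> u < 1 \<Longrightarrow> quaternary_index k u < 4 ^ k"
proof -
  assume "0 \<le> u" "u < 1"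
  then have "\<lfloor>4 ^ k * u\<rfloor> < 4 ^ k" by (simp add: floor_less_iff)
  then show ?thesis unfolding quaternary_index_def by (simp add: nat_less_iff)
qed

text \<open>Passing to the coarser level drops the last \<open>K - k\<close> digits in base
  4.\<close>

lemma quaternary_index_div:
  assumes "k \<le> K" "0 \<le> u"
  shows "quaternary_index k u = quaternary_index K u div 4 ^ (K - k)"
proof -
  have "(4::real) ^ K = 4 ^ k * 4 ^ (K - k)" using assms by (simp flip: power_add)
  then have "\<lfloor>4 ^ k * u\<rfloor> = \<lfloor>(4 ^ K * u) / real_of_int (4 ^ (K - k))\<rfloor>" by simp
  also have "\<dots> = \<lfloor>4 ^ K * u\<rfloor> div 4 ^ (K - k)" by (rule floor_divide_real_eq_div) simp
  finally show ?thesis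
    using assms by (simp add: quaternary_index_def nat_div_distrib nat_power_eq)
qed

lemma quaternary_index_mono:
  assumes "quaternary_index K u = quaternary_index K s" "k \<le> K" "0 \<le> u" "0 \<le> s"
  shows "quaternary_index k u = quaternary_index k s"
  using assms by (simp add: quaternary_index_div)

lemma quaternary_interval_dyadic:
  assumes "0 \<le> s" "s < 1"
  shows "quaternary_interval k (quaternary_index k s) \<in> dyadic_unit_intervals"
  unfolding dyadic_unit_intervals_def
proof (intro CollectI exI conjI)
  let ?j = "Suc (quaternary_index k s)"
  show "quaternary_interval k (quaternary_index k s) = {real (?j - 1) / 2 ^ (2 * k) ..< real ?j / 2 ^ (2 * k)}"
    by (simp add: quaternary_interval_def power_mult)
  show "1 \<le> ?j" by simp
  show "?j \<le> 2 ^ (2 * k)" using quaternary_index_less[OF assms, of k] by (simp add: power_mult)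
qed

lemma quaternary_interval_lmeasurable: "quaternary_interval k m \<in> lmeasurable"
  unfolding quaternary_interval_def by (rule bounded_set_imp_lmeasurable) auto

lemma measure_quaternary_interval: "measure lebesgue (quaternary_interval k m) = 1 / 4 ^ k"
proof -
  have "real m / 4 ^ k \<le> real (Suc m) / 4 ^ k" by (intro divide_right_mono) auto
  then show ?thesis by (simp add: quaternary_interval_def field_simps)
qed

lemma simple_function_quaternary_index:
  assumes "Q \<subseteq> {0..<1}" "Q \<in> sets lebesgue"
  shows "simple_function (lebesgue_on Q) (quaternary_index K)"
  unfolding simple_function_def
proof (intro conjI ballI)
  have "quaternary_index K ` space (lebesgue_on Q) \<subseteq> {..<4 ^ K}"
    using assms(1) quaternary_index_less by (auto simp: space_restrict_space)
  then show "finite (quaternary_index K ` space (lebesgue_on Q))" by (rule finite_subset) simp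
  fix t
  have "quaternary_index K -` {t} \<inter> space (lebesgue_on Q) = quaternary_interval K t \<inter> Q"
    using assms(1) by (auto simp: mem_quaternary_interval space_restrict_space)
  then show "quaternary_index K -` {t} \<inter> space (lebesgue_on Q) \<in> sets (lebesgue_on Q)"
    using quaternary_interval_lmeasurable[of K t] assms(2)
    by (auto simp: sets_restrict_space_iff)
qed

text \<open>A point that leaves the chain of intervals around \<open>s\<close> does so after exactly
  one level \<open>k\<close>, and its interval of level \<open>K\<close> determines that
  \<open>k\<close>. So the sign can be prescribed independently on each difference of consecutive
  intervals by a set \<open>w\<close> of intervals of level \<open>K\<close>.\<close>

lemma sign_pattern:
  fixes s :: real and \<eta> :: "nat \<Rightarrow> bool"
  assumes s: "0 \<le> s"
  shows "\<exists>w \<subseteq> {..<4 ^ K}. \<forall>k<K. \<forall>u. 0 \<le> u \<longrightarrow> u < 1 \<longrightarrow>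
    quaternary_index k u = quaternary_index k s \<longrightarrow>
    quaternary_index (Suc k) u \<noteq> quaternary_index (Suc k) s \<longrightarrow>
    (quaternary_index K u \<in> w \<longleftrightarrow> \<eta> k)"
proof -
  define w where "w = quaternary_index K ` {u. 0 \<le> u \<and> u < 1 \<and> (\<exists>k<K. \<eta> k \<and>
    quaternary_index k u = quaternary_index k s \<and>
    quaternary_index (Suc k) u \<noteq> quaternary_index (Suc k) s)}"
  have "w \<subseteq> {..<4 ^ K}" by (auto simp: w_def quaternary_index_less)
  moreover have "quaternary_index K u \<in> w \<longleftrightarrow> \<eta> k"
    if k: "k < K" and u: "0 \<le> u" "u < 1" and eq: "quaternary_index k u = quaternary_index k s"
      and ne: "quaternary_index (Suc k) u \<noteq> quaternary_index (Suc k) s" for k u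
  proof
    assume "quaternary_index K u \<in> w"
    then obtain u' k' where u': "0 \<le> u'" "quaternary_index K u = quaternary_index K u'"
      and k': "k' < K" "\<eta> k'" "quaternary_index k' u' = quaternary_index k' s"
        "quaternary_index (Suc k') u' \<noteq> quaternary_index (Suc k') s"
      by (auto simp: w_def)
    have same: "quaternary_index l u = quaternary_index l u'" if "l \<le> K" for l
      using quaternary_index_mono[OF u'(2) that] u u' by simp
    \<comment> \<open>\<open>u\<close> and \<open>u'\<close> share an interval of level
      \<open>K\<close>, hence agree at all levels. Agreement with \<open>s\<close> at the later
      level would force agreement at the earlier one's successor, against the exit there.\<close>
    have "\<not> k < k'"
      using quaternary_index_mono[OF k'(3), of "Suc k"] u' s ne same[of "Suc k"] k by auto
    moreover have "\<not> k' < k"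
      using quaternary_index_mono[OF eq, of "Suc k'"] u s k' same[of "Suc k'"] k by auto
    ultimately have "k = k'" by simp
    then show "\<eta> k" using k' by simp
  next
    assume "\<eta> k"
    then show "quaternary_index K u \<in> w" unfolding w_def using k u eq ne by blast
  qed
  ultimately show ?thesis by blast
qed

context lattice_scalars
begin

text \<open>The vectors \<open>\<Sum>w. \<plusminus> x w\<close>, with sign + when \<open>t \<in> w\<close>, span a copy of \<open>\<ell>\<^sup>1\<close> over the atoms \<open>t\<close>: for
  each realisation of \<open>\<epsilon>\<close> one picks the \<open>w\<close> whose signs match those of \<open>\<epsilon>\<close> along the cubes around \<open>s\<close>.\<close>

lemma rademacher_maximal_sign_sum_ge:
  fixes x :: "nat set \<Rightarrow> 'a"
  assumes K: "K > 0" and x: "disjoint_pos (Pow {..<4 ^ K}) x" "\<And>w. w \<subseteq> {..<4 ^ K} \<Longrightarrow> norm (x w) = 1"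
  defines "f \<equiv> \<lambda>u. \<Sum>w\<in>Pow {..<4 ^ K}. (if quaternary_index K u \<in> w then 1 else - 1 :: real) *\<^sub>R J (x w)"
  assumes s: "0 \<le> s" "s < 1"
  shows "ennreal (sqrt K / (2 * DIM('k))) \<le> rademacher_maximal scl dyadic_unit_intervals f s"
proof -
  define I where "I = Pow {..<(4::nat) ^ K}"
  define g where "g w u = (if quaternary_index K u \<in> w then 1 else - 1 :: real)" for w u
  define Q where "Q k = quaternary_interval k (quaternary_index k s)" for k
  define F where "F = Q ` {..<K}"
  define a where "a k w = integral\<^sup>L (lebesgue_on (Q k)) (g w) / measure lebesgue (Q k)" for k w
  have I: "finite I" by (simp add: I_def)
  have f: "f = (\<lambda>u. \<Sum>w\<in>I. g w u *\<^sub>R J (x w))" by (simp add: f_def I_def g_def)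
  have Qm: "Q k \<in> lmeasurable" "measure lebesgue (Q k) = 1 / 4 ^ k" for k
    by (auto simp: Q_def quaternary_interval_lmeasurable measure_quaternary_interval)
  have sQ: "s \<in> Q k" for k using s by (simp add: Q_def mem_quaternary_interval)
  have Qsub: "Q k \<subseteq> {0..<1}" for k
  proof
    fix u assume "u \<in> Q k"
    then have u: "0 \<le> u" "quaternary_index k u = quaternary_index k s"
      by (auto simp: Q_def mem_quaternary_interval)
    have "quaternary_index 0 u = quaternary_index 0 s"
      by (rule quaternary_index_mono[OF u(2) _ u(1) s(1)]) simp
    also have "\<dots> = 0" using quaternary_index_less[OF s, of 0] by simp
    finally show "u \<in> {0..<1}" using u(1) by (simp add: quaternary_index_def)
  qed
  have inj: "inj_on Q {..<K}"
  proof (rule inj_onI)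
    fix k l assume "Q k = Q l"
    then have "1 / 4 ^ k = (1 / 4 ^ l :: real)" using Qm(2) by metis
    then show "k = l" by simp
  qed
  have g_simple: "simple_function (lebesgue_on (Q k)) (g w)" for k w
    unfolding g_def
    by (rule simple_function_compose1[where g = "\<lambda>t. if t \<in> w then 1 else - 1"])
      (use simple_function_quaternary_index[OF Qsub] Qm(1) in auto)
  have avg: "average (Q k) f = (\<Sum>w\<in>I. a k w *\<^sub>R J (x w))" for k
    unfolding f a_def by (rule average_sum_scaleR[OF Qm(1) g_simple I])
  have "sqrt K / (2 * DIM('k)) \<le> norm (\<Sum>R\<in>F. scl (\<epsilon> R) (average R f)) / sqrt (card F)"
    if \<epsilon>: "\<And>R. R \<in> F \<Longrightarrow> norm (\<epsilon> R) = 1" for \<epsilon> :: "real set \<Rightarrow> 'k"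
  proof -
    have "(\<Sum>k<K. 1) \<le> (\<Sum>k<K. \<Sum>b\<in>Basis. \<bar>\<epsilon> (Q k) \<bullet> b\<bar>)"
    proof (rule sum_mono)
      fix k assume "k \<in> {..<K}"
      then show "1 \<le> (\<Sum>b\<in>Basis. \<bar>\<epsilon> (Q k) \<bullet> b\<bar>)"
        using norm_le_l1[of "\<epsilon> (Q k)"] \<epsilon>[of "Q k"] by (simp add: F_def)
    qed
    then have tot: "real K \<le> (\<Sum>b\<in>Basis. \<Sum>k<K. \<bar>\<epsilon> (Q k) \<bullet> b\<bar>)"
      by (subst sum.swap) simp
    \<comment> \<open>Pigeonhole over the coordinates of the scalar field: the source of the factor
      \<open>DIM('k)\<close>, which is 1 in the real and 2 in the complex case.\<close>
    have "\<exists>b\<in>Basis. real K / DIM('k) \<le> (\<Sum>k<K. \<bar>\<epsilon> (Q k) \<bullet> b\<bar>)"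
    proof (rule ccontr)
      assume "\<not> ?thesis"
      then have "(\<Sum>b\<in>Basis. \<Sum>k<K. \<bar>\<epsilon> (Q k) \<bullet> b\<bar>) < (\<Sum>b\<in>(Basis :: 'k set). real K / DIM('k))"
        by (intro sum_strict_mono) auto
      with tot show False by simp
    qed
    then obtain b where b: "b \<in> Basis" "real K / DIM('k) \<le> (\<Sum>k<K. \<bar>\<epsilon> (Q k) \<bullet> b\<bar>)" by blast
    define \<eta> where "\<eta> k \<longleftrightarrow> 0 \<le> \<epsilon> (Q k) \<bullet> b" for k
    obtain w where w: "w \<in> I" "\<And>k u. k < K \<Longrightarrow> 0 \<le> u \<Longrightarrow> u < 1 \<Longrightarrow>
        quaternary_index k u = quaternary_index k s \<Longrightarrow>
        quaternary_index (Suc k) u \<noteq> quaternary_index (Suc k) s \<Longrightarrow>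
        quaternary_index K u \<in> w \<longleftrightarrow> \<eta> k"
      using sign_pattern[OF s(1), of K \<eta>] unfolding I_def by blast
    \<comment> \<open>The coefficient of \<open>x v\<close> in the randomised sum. The single
      coefficient of the matching \<open>w\<close> already gives the lower bound, since there all
      \<open>K\<close> terms have the same sign.\<close>
    define c where "c v = (\<Sum>k<K. a k v *\<^sub>R \<epsilon> (Q k))" for v
    have ge: "\<bar>\<epsilon> (Q k) \<bullet> b\<bar> / 2 \<le> a k w * (\<epsilon> (Q k) \<bullet> b)" if k: "k < K" for k
    proof -
      let ?M = "lebesgue_on (Q k)"
      interpret finite_measure ?M using Qm(1) by (rule finite_measure_lebesgue_on)
      define \<sigma> :: real where "\<sigma> = (if \<eta> k then 1 else - 1)"
      have meas: "Q (Suc k) \<in> sets lebesgue" "Q k \<in> sets lebesgue" using Qm(1) by auto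
      have sub: "Q (Suc k) \<subseteq> Q k"
      proof
        fix u assume "u \<in> Q (Suc k)"
        then have u: "0 \<le> u" "quaternary_index (Suc k) u = quaternary_index (Suc k) s"
          by (auto simp: Q_def mem_quaternary_interval)
        have "quaternary_index k u = quaternary_index k s"
          by (rule quaternary_index_mono[OF u(2) _ u(1) s(1)]) simp
        then show "u \<in> Q k" using u(1) by (simp add: Q_def mem_quaternary_interval)
      qed
      then have measM: "Q (Suc k) \<in> sets ?M" using meas by (auto simp: sets_restrict_space_iff)
      have "measure ?M (Q (Suc k)) = 1 / 4 ^ Suc k"
        using sub meas Qm(2) by (simp add: measure_restrict_space)
      moreover have "measure ?M (Q k) = 1 / 4 ^ k"
        using meas Qm(2) by (simp add: measure_restrict_space)
      moreover have ind: "integrable ?M (\<lambda>u. indicator (Q (Suc k)) u :: real)"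
        using measM by (simp add: less_top[symmetric])
      ultimately have "integral\<^sup>L ?M (\<lambda>u. 1 - 2 * indicator (Q (Suc k)) u :: real)
          = 1 / 4 ^ k - 2 * (1 / 4 ^ Suc k)"
        using sub by (subst Bochner_Integration.integral_diff) (auto simp: Int_absorb2)
      moreover have "integral\<^sup>L ?M (\<lambda>u. 1 - 2 * indicator (Q (Suc k)) u) \<le> integral\<^sup>L ?M (\<lambda>u. \<sigma> * g w u)"
      proof (rule integral_mono)
        show "integrable ?M (\<lambda>u. 1 - 2 * indicator (Q (Suc k)) u :: real)"
          using ind by (intro Bochner_Integration.integrable_diff) auto
        show "integrable ?M (\<lambda>u. \<sigma> * g w u)"
          by (rule integrable_const_bound[where B = 1])
            (auto simp: \<sigma>_def g_def[abs_def] intro!: borel_measurable_times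
              borel_measurable_simple_function[OF g_simple[unfolded g_def[abs_def]]])
        fix u assume "u \<in> space ?M"
        then have uQ: "u \<in> Q k" by simp
        then have u: "0 \<le> u" "u < 1" "quaternary_index k u = quaternary_index k s"
          using Qsub[of k] by (auto simp: Q_def mem_quaternary_interval)
        show "1 - 2 * indicator (Q (Suc k)) u \<le> \<sigma> * g w u"
        proof (cases "u \<in> Q (Suc k)")
          case True
          then show ?thesis by (simp add: \<sigma>_def g_def)
        next
          case False
          then have "quaternary_index (Suc k) u \<noteq> quaternary_index (Suc k) s"
            using u by (simp add: Q_def mem_quaternary_interval)
          from w(2)[OF k u this] False show ?thesis by (simp add: \<sigma>_def g_def)
        qed
      qed
      ultimately have "1 / 4 ^ k - 2 * (1 / 4 ^ Suc k) \<le> \<sigma> * integral\<^sup>L ?M (g w)" by simp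
      then have "(1 / 4 ^ k) / 2 \<le> \<sigma> * (a k w * (1 / 4 ^ k))"
        by (simp add: a_def Qm(2))
      then have "1 / 2 \<le> \<sigma> * a k w" by (simp add: field_simps)
      then have "\<bar>\<epsilon> (Q k) \<bullet> b\<bar> * (1 / 2) \<le> \<bar>\<epsilon> (Q k) \<bullet> b\<bar> * (\<sigma> * a k w)"
        by (intro mult_left_mono) auto
      also have "\<dots> = a k w * (\<epsilon> (Q k) \<bullet> b)" by (simp add: \<sigma>_def \<eta>_def)
      finally show ?thesis by simp
    qed
    have "real K / DIM('k) / 2 \<le> (\<Sum>k<K. \<bar>\<epsilon> (Q k) \<bullet> b\<bar>) / 2" using b(2) by simp
    also have "\<dots> = (\<Sum>k<K. \<bar>\<epsilon> (Q k) \<bullet> b\<bar> / 2)" by (simp add: sum_divide_distrib)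
    also have "\<dots> \<le> (\<Sum>k<K. a k w * (\<epsilon> (Q k) \<bullet> b))" by (intro sum_mono ge) auto
    also have "\<dots> = c w \<bullet> b" by (simp add: c_def inner_sum_left)
    also have "\<dots> \<le> \<bar>c w \<bullet> b\<bar> * norm (x w)" using x(2)[of w] w(1) by (simp add: I_def)
    also have "\<dots> \<le> norm (\<Sum>v\<in>I. scl (c v) (J (x v)))"
      using x(1) by (intro norm_sum_scl_J_ge I w(1) b(1)) (simp add: I_def)
    also have "(\<Sum>v\<in>I. scl (c v) (J (x v))) = (\<Sum>k<K. scl (\<epsilon> (Q k)) (average (Q k) f))"
      unfolding avg c_def scl_sum_left scl_sum_right by (subst sum.swap) (simp add: scl_scaleR)
    also have "\<dots> = (\<Sum>R\<in>F. scl (\<epsilon> R) (average R f))"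
      unfolding F_def by (simp add: sum.reindex[OF inj])
    finally have "real K / DIM('k) / 2 / sqrt K \<le> norm (\<Sum>R\<in>F. scl (\<epsilon> R) (average R f)) / sqrt K"
      by (intro divide_right_mono) auto
    moreover have "real K / DIM('k) / 2 / sqrt K = sqrt K / (2 * DIM('k))"
      using K by (simp add: field_simps)
    moreover have "card F = K" unfolding F_def by (simp add: card_image[OF inj])
    ultimately show ?thesis by simp
  qed
  then show ?thesis
    using K sQ quaternary_interval_dyadic[OF s]
    by (intro rademacher_maximal_ge[of F]) (auto simp: F_def Q_def)
qed

text \<open>The sign functions are bounded by \<open>A\<close> for every \<open>K\<close>, but their
  maximal function is at least \<open>sqrt K / (2 * DIM('k))\<close> on all of [0,1). The index type
  \<open>nat set\<close> accommodates the sets \<open>w\<close> of intervals.\<close>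

lemma RMF_unbounded_disjoint_sums:
  assumes RMF: "RMF_property scl"
    and dim: "infinite_dimensional (scaleR :: real \<Rightarrow> 'a \<Rightarrow> 'a)"
    and bound: "\<And>(I :: nat set set) x :: nat set \<Rightarrow> 'a. finite I \<Longrightarrow> disjoint_pos I x \<Longrightarrow>
      (\<And>i. i \<in> I \<Longrightarrow> norm (x i) = 1) \<Longrightarrow> norm (sum x I) \<le> A"
  shows False
proof -
  let ?M = "lebesgue_on {0..<1::real}"
  have A: "0 \<le> A" using bound[of "{}" "\<lambda>_. 0"] by (simp add: disjoint_pos_def)
  obtain p C where p: "p > 1" and C: "C \<ge> 0" and RMF: "\<And>f :: real \<Rightarrow> 'x.
      strongly_measurable ?M f \<Longrightarrow> (\<integral>\<^sup>+s. ennreal (norm (f s) powr p) \<partial>?M) < \<infinity> \<Longrightarrow>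
      (AE s in ?M. rademacher_maximal scl dyadic_unit_intervals f s < \<infinity>) \<and>
      (\<integral>\<^sup>+s. ennreal (enn2real (rademacher_maximal scl dyadic_unit_intervals f s) powr p) \<partial>?M)
        \<le> ennreal (C powr p) * (\<integral>\<^sup>+s. ennreal (norm (f s) powr p) \<partial>?M)"
    using RMF unfolding RMF_property_def by metis
  \<comment> \<open>The threshold beyond which \<open>sqrt K / (2 * DIM('k))\<close> exceeds
    \<open>C * A\<close>.\<close>
  define L where "L = C * A * (2 * DIM('k))"
  obtain K :: nat where K: "real K > L\<^sup>2" using reals_Archimedean2 by blast
  have "0 < real K" using K zero_le_power2[of L] by linarith
  then have K0: "K > 0" by simp
  obtain x :: "nat set \<Rightarrow> 'a" where x: "disjoint_pos (Pow {..<4 ^ K}) x"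
    "\<And>w. w \<in> Pow {..<4 ^ K} \<Longrightarrow> norm (x w) = 1"
    using infinite_dimensional_disjoint_pos[OF dim, of "Pow {..<4 ^ K}"] by auto
  define f where "f = (\<lambda>u. \<Sum>w\<in>Pow {..<4 ^ K}.
    (if quaternary_index K u \<in> w then 1 else - 1 :: real) *\<^sub>R J (x w))"
  define l where "l = sqrt K / (2 * DIM('k))"
  have space: "space ?M = {0..<1}" by simp
  have one: "emeasure ?M {0..<1} = 1" by (simp add: emeasure_restrict_space)
  have f_le: "norm (f u) \<le> A" for u
  proof -
    have "norm (f u) = norm (\<Sum>w\<in>Pow {..<4 ^ K}.
        scl (of_real (if quaternary_index K u \<in> w then 1 else - 1)) (J (x w)))"
      unfolding f_def scl_of_real ..
    also have "\<dots> \<le> norm (\<Sum>w\<in>Pow {..<4 ^ K}. 1 *\<^sub>R x w)"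
      using x(1) by (intro norm_sum_scl_J_le) (auto simp: disjoint_pos_def)
    also have "\<dots> \<le> A" using bound[OF _ x] by simp
    finally show ?thesis .
  qed
  have "simple_function ?M f"
    unfolding f_def
    by (rule simple_function_compose1[OF simple_function_quaternary_index,
        where g = "\<lambda>t. \<Sum>w\<in>Pow {..<4 ^ K}. (if t \<in> w then 1 else - 1 :: real) *\<^sub>R J (x w)"]) auto
  then have sm: "strongly_measurable ?M f"
    unfolding strongly_measurable_def by (intro exI[of _ "\<lambda>_. f"]) auto
  have "(\<integral>\<^sup>+s. ennreal (norm (f s) powr p) \<partial>?M) \<le> (\<integral>\<^sup>+s. ennreal (A powr p) \<partial>?M)"
    using f_le p by (intro nn_integral_mono ennreal_leI powr_mono2) auto
  also have "\<dots> = ennreal (A powr p)" by (simp add: one)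
  finally have fA: "(\<integral>\<^sup>+s. ennreal (norm (f s) powr p) \<partial>?M) \<le> ennreal (A powr p)" .
  then have fin: "(\<integral>\<^sup>+s. ennreal (norm (f s) powr p) \<partial>?M) < \<infinity>"
    by (rule order_le_less_trans) simp
  note R = RMF[OF sm fin]
  have "ennreal (l powr p) = (\<integral>\<^sup>+s. ennreal (l powr p) \<partial>?M)" by (simp add: one)
  also have "\<dots> \<le> (\<integral>\<^sup>+s. ennreal (enn2real (rademacher_maximal scl dyadic_unit_intervals f s) powr p) \<partial>?M)"
  proof (rule nn_integral_mono_AE)
    \<comment> \<open>\<open>enn2real\<close> sends infinity to 0, so the lower bound survives only
      where the maximal function is finite; the RMF property provides this almost
      everywhere.\<close>
    show "AE s in ?M. ennreal (l powr p)
      \<le> ennreal (enn2real (rademacher_maximal scl dyadic_unit_intervals f s) powr p)"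
      using R[THEN conjunct1] AE_space
    proof eventually_elim
      fix s assume fin: "rademacher_maximal scl dyadic_unit_intervals f s < \<infinity>" and "s \<in> space ?M"
      then have "ennreal l \<le> rademacher_maximal scl dyadic_unit_intervals f s"
        unfolding l_def f_def using x by (intro rademacher_maximal_sign_sum_ge K0) auto
      then have "l \<le> enn2real (rademacher_maximal scl dyadic_unit_intervals f s)"
        using fin enn2real_mono[of "ennreal l"] by (simp add: l_def)
      then show "ennreal (l powr p) \<le> ennreal (enn2real (rademacher_maximal scl dyadic_unit_intervals f s) powr p)"
        using p by (intro ennreal_leI powr_mono2) (auto simp: l_def)
    qed
  qed
  also have "\<dots> \<le> ennreal (C powr p) * ennreal (A powr p)"
    using R[THEN conjunct2] mult_left_mono[OF fA, of "ennreal (C powr p)"] by (meson order_trans zero_le)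
  also have "\<dots> = ennreal ((C * A) powr p)" using C A by (simp add: powr_mult ennreal_mult)
  finally have "l powr p \<le> (C * A) powr p" by simp
  then have "l \<le> C * A"
    using p C A powr_less_mono2[of p "C * A" l] by (intro leI notI) auto
  then have "sqrt K \<le> L" by (simp add: l_def L_def field_simps)
  then have "(sqrt K)\<^sup>2 \<le> L\<^sup>2" by (intro power_mono) auto
  with K show False by simp
qed

end

section \<open>The lattice maximal function on annuli\<close>

definition half_open_cube :: "real ^ 'n \<Rightarrow> real \<Rightarrow> (real ^ 'n) set" where
  "half_open_cube a r = {y. \<forall>c. a $ c \<le> y $ c \<and> y $ c < a $ c + r}"

lemma half_open_cube_lmeasurable: "half_open_cube a r \<in> lmeasurable"
proof (rule bounded_set_imp_lmeasurable)
  have "half_open_cube a r \<subseteq> cbox a (\<chi> c. a $ c + r)"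
    by (auto simp: half_open_cube_def mem_box_cart less_imp_le)
  then show "bounded (half_open_cube a r)" using bounded_cbox bounded_subset by blast
  have "half_open_cube a r = (\<Inter>c\<in>UNIV. {y. a $ c \<le> y $ c} \<inter> {y. y $ c < a $ c + r})"
    by (auto simp: half_open_cube_def)
  also have "\<dots> \<in> sets borel"
    by (intro sets.finite_INT sets.Int borel_closed borel_open closed_Collect_le open_Collect_less
        continuous_intros) auto
  finally show "half_open_cube a r \<in> sets lebesgue" by auto
qed

lemma half_open_cube_image:
  assumes "r > 0"
  shows "(\<lambda>x. r *\<^sub>R (x + m)) ` {x. \<forall>c. x $ c \<in> {0..<1}} = half_open_cube (r *\<^sub>R m) r"
proof (intro set_eqI iffI)
  fix y assume "y \<in> half_open_cube (r *\<^sub>R m) r"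
  then have y: "r * m $ c \<le> y $ c" "y $ c < r * m $ c + r" for c
    by (auto simp: half_open_cube_def)
  have "0 \<le> ((1 / r) *\<^sub>R y - m) $ c" "((1 / r) *\<^sub>R y - m) $ c < 1" for c
    using y[of c] assms by (auto simp: field_simps)
  moreover have "y = r *\<^sub>R (((1 / r) *\<^sub>R y - m) + m)" using assms by simp
  ultimately show "y \<in> (\<lambda>x. r *\<^sub>R (x + m)) ` {x. \<forall>c. x $ c \<in> {0..<1}}"
    by (intro image_eqI[of _ _ "(1 / r) *\<^sub>R y - m"]) auto
qed (use assms in \<open>auto simp: half_open_cube_def algebra_simps\<close>)

lemma measure_half_open_cube:
  assumes "r > 0"
  shows "measure lebesgue (half_open_cube (0 :: real ^ 'n) r)
    = r ^ CARD('n) * measure lebesgue (half_open_cube (0 :: real ^ 'n) 1)"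
proof -
  have "half_open_cube (0 :: real ^ 'n) r = (\<lambda>x. r *\<^sub>R x) ` half_open_cube 0 1"
    using half_open_cube_image[OF assms, of "0 :: real ^ 'n"] half_open_cube_image[of 1 "0 :: real ^ 'n"]
    by simp
  then show ?thesis
    using measure_lebesgue_affine[of r 0 "half_open_cube (0 :: real ^ 'n) 1"] assms by simp
qed

lemma measure_half_open_cube_pos: "measure lebesgue (half_open_cube (0 :: real ^ 'n) 1) > 0"
proof -
  have "cbox 0 (\<chi> c. 1 / 2) \<subseteq> half_open_cube (0 :: real ^ 'n) 1"
  proof
    fix y :: "real ^ 'n" assume "y \<in> cbox 0 (\<chi> c. 1 / 2)"
    then have "0 \<le> y $ c" "y $ c \<le> 1 / 2" for c by (auto simp: mem_box_cart)
    then have "0 \<le> y $ c \<and> y $ c < 1" for c by (smt (verit) field_sum_of_halves)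
    then show "y \<in> half_open_cube 0 1" by (simp add: half_open_cube_def)
  qed
  then have "measure lebesgue (cbox 0 (\<chi> c. 1 / 2) :: (real ^ 'n) set)
      \<le> measure lebesgue (half_open_cube (0 :: real ^ 'n) 1)"
    by (intro measure_mono_fmeasurable half_open_cube_lmeasurable) auto
  moreover have "cbox 0 (\<chi> c. 1 / 2) \<noteq> ({} :: (real ^ 'n) set)"
    by (auto simp: interval_ne_empty_cart)
  then have "0 < measure lebesgue (cbox 0 (\<chi> c. 1 / 2) :: (real ^ 'n) set)"
    by (simp add: content_cbox_cart)
  ultimately show ?thesis by linarith
qed

text \<open>For side at least 1 the integer coordinates of \<open>m\<close> lie strictly between -1
  and 1, hence vanish. For side \<open>1 / R\<close> they lie between 0 and \<open>R - 1\<close>,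
  which keeps the cube inside the unit cube.\<close>

lemma dyadic_cubes_containing:
  fixes s :: "real ^ 'n"
  assumes Q: "Q \<in> dyadic_cubes" and sQ: "s \<in> Q" and s: "s \<in> half_open_cube 0 1"
  shows "(\<exists>i. Q = half_open_cube 0 (2 ^ i)) \<or> Q \<subseteq> half_open_cube 0 1"
proof -
  from Q obtain k :: int and m :: "real ^ 'n" where m: "\<And>c. m $ c \<in> \<int>"
    and Q: "Q = (\<lambda>x. (2 powi (- k)) *\<^sub>R (x + m)) ` {x. \<forall>c. x $ c \<in> {0..<1}}"
    unfolding dyadic_cubes_def by blast
  define r :: real where "r = 2 powi (- k)"
  have r: "r > 0" by (simp add: r_def)
  have Qr: "Q = half_open_cube (r *\<^sub>R m) r" unfolding Q r_def[symmetric] by (rule half_open_cube_image[OF r])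
  have 1: "r * m $ c \<le> s $ c" "s $ c < r * m $ c + r" "0 \<le> s $ c" "s $ c < 1" for c
    using sQ s unfolding Qr by (auto simp: half_open_cube_def)
  show ?thesis
  proof (cases "k \<le> 0")
    case True
    define i where "i = nat (- k)"
    have ri: "r = 2 ^ i" using True by (simp add: r_def i_def power_int_def)
    have "m $ c = 0" for c
    proof -
      obtain z where z: "m $ c = of_int z" using m[of c] by (auto elim: Ints_cases)
      have "r * m $ c < r * 1" using 1[of c] one_le_power[of "2::real" i] unfolding ri by linarith
      then have "m $ c < 1" using r by (simp only: mult_less_cancel_left_pos)
      moreover have "r * (- 1) < r * m $ c" using 1[of c] by simp
      then have "- 1 < m $ c" using r by (simp only: mult_less_cancel_left_pos)
      ultimately have "z = 0" unfolding z by linarith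
      then show ?thesis using z by simp
    qed
    then have "m = 0" by (simp add: vec_eq_iff)
    then show ?thesis using Qr ri by auto
  next
    case False
    define R where "R = (2::int) ^ nat k"
    have "(2::real) powi k = 2 ^ nat k" using False by (simp add: power_int_def)
    then have rR: "r = 1 / of_int R" "of_int R > (0::real)"
      by (simp_all add: r_def R_def power_int_minus divide_inverse)
    have "Q \<subseteq> half_open_cube 0 1"
    proof
      fix y assume "y \<in> Q"
      then have y: "r * m $ c \<le> y $ c" "y $ c < r * m $ c + r" for c
        unfolding Qr by (auto simp: half_open_cube_def)
      have "0 \<le> y $ c \<and> y $ c < 1" for c
      proof -
        obtain z where z: "m $ c = of_int z" using m[of c] by (auto elim: Ints_cases)
        have rR1: "r * of_int R = 1" using rR by simp
        have "r * of_int z < r * of_int R" using 1[of c] unfolding z rR1 by linarith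
        then have zR: "z + 1 \<le> R" using r by simp
        have "r * (- 1) < r * m $ c" using 1[of c] by simp
        then have "- 1 < m $ c" using r by (simp only: mult_less_cancel_left_pos)
        then have z0: "0 \<le> z" using z by linarith
        have "0 \<le> r * m $ c" using r z0 z by simp
        moreover have "r * m $ c + r = r * of_int (z + 1)" using z by (simp add: algebra_simps)
        moreover have "r * of_int (z + 1) \<le> r * of_int R"
          using r zR by (intro mult_left_mono) (auto simp del: of_int_add)
        ultimately show ?thesis using y[of c] rR1 by linarith
      qed
      then show "y \<in> half_open_cube 0 1" by (simp add: half_open_cube_def)
    qed
    then show ?thesis ..
  qed
qed

lemma half_open_cube_dyadic: "half_open_cube 0 (2 ^ i) \<in> dyadic_cubes"
proof -
  have "half_open_cube (0 :: real ^ 'n) (2 ^ i)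
      = (\<lambda>x. (2 powi (- (- int i))) *\<^sub>R (x + 0)) ` {x. \<forall>c. x $ c \<in> {0..<1}}"
    using half_open_cube_image[of "2 ^ i" "0 :: real ^ 'n"] by simp
  then show ?thesis unfolding dyadic_cubes_def by (intro CollectI exI[of _ "- int i"] exI[of _ 0] conjI) auto
qed

lemma dyadic_cubes_lmeasurable: "Q \<in> dyadic_cubes \<Longrightarrow> Q \<in> lmeasurable"
  unfolding dyadic_cubes_def
  by (auto simp: half_open_cube_lmeasurable half_open_cube_image[unfolded atLeastLessThan_iff])

text \<open>Cauchy-Schwarz for \<open>c j * sqrt (a i j)\<close> and \<open>sqrt (a i j)\<close>,
  followed by an exchange of sums. It is applied with \<open>i\<close> an annulus and
  \<open>j\<close> a cube.\<close>

lemma schur_test: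
  fixes a :: "'i \<Rightarrow> 'j \<Rightarrow> real"
  assumes a: "\<And>i j. 0 \<le> a i j"
    and row: "\<And>j. j \<in> F \<Longrightarrow> (\<Sum>i\<in>I. a i j) \<le> 1" and col: "\<And>i. i \<in> I \<Longrightarrow> (\<Sum>j\<in>F. a i j) \<le> 1"
  shows "(\<Sum>i\<in>I. (\<Sum>j\<in>F. c j * a i j)\<^sup>2) \<le> (\<Sum>j\<in>F. (c j)\<^sup>2)"
proof -
  have "(\<Sum>j\<in>F. c j * a i j)\<^sup>2 \<le> (\<Sum>j\<in>F. (c j)\<^sup>2 * a i j)" if "i \<in> I" for i
  proof -
    have "(\<Sum>j\<in>F. c j * a i j) = (\<Sum>j\<in>F. (c j * sqrt (a i j)) * sqrt (a i j))"
      using a by (simp add: mult.assoc)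
    then have "(\<Sum>j\<in>F. c j * a i j)\<^sup>2 \<le> (\<Sum>j\<in>F. (c j * sqrt (a i j))\<^sup>2) * (\<Sum>j\<in>F. (sqrt (a i j))\<^sup>2)"
      by (metis Cauchy_Schwarz_ineq_sum)
    also have "\<dots> = (\<Sum>j\<in>F. (c j)\<^sup>2 * a i j) * (\<Sum>j\<in>F. a i j)"
      using a by (simp add: power_mult_distrib)
    also have "\<dots> \<le> (\<Sum>j\<in>F. (c j)\<^sup>2 * a i j)"
      using col[OF that] a by (intro mult_right_le_one_le sum_nonneg) auto
    finally show ?thesis .
  qed
  then have "(\<Sum>i\<in>I. (\<Sum>j\<in>F. c j * a i j)\<^sup>2) \<le> (\<Sum>i\<in>I. \<Sum>j\<in>F. (c j)\<^sup>2 * a i j)"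
    by (rule sum_mono)
  also have "\<dots> = (\<Sum>j\<in>F. (c j)\<^sup>2 * (\<Sum>i\<in>I. a i j))"
    by (subst sum.swap) (simp add: sum_distrib_left)
  also have "\<dots> \<le> (\<Sum>j\<in>F. (c j)\<^sup>2)"
    using row a by (intro sum_mono mult_left_le) auto
  finally show ?thesis .
qed


context lattice_scalars
begin

text \<open>The test function takes the value \<open>x j\<close> on the annulus \<open>[0,2\<^sup>j)\<^sup>d - [0,2\<^sup>j\<^sup>-\<^sup>1)\<^sup>d\<close>. At a
  point of the unit cube, only the cubes \<open>[0,2\<^sup>i)\<^sup>d\<close> see it, and the averages of the annuli over
  them form a matrix to which Schur's test applies.\<close>

lemma maximal_comparison_l2:
  fixes x :: "nat \<Rightarrow> 'a"
  assumes C: "C > 0"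
    and H: "\<And>f :: real ^ 'n \<Rightarrow> 'x. Bochner_Integration.simple_bochner_integrable lebesgue f \<Longrightarrow>
      AE s in lebesgue. ennreal (norm (lattice_maximal dyadic_cubes f s))
        \<le> ennreal C * rademacher_maximal scl dyadic_cubes f s"
    and x: "disjoint_pos {1..K} x"
    and B: "\<And>\<mu> :: nat \<Rightarrow> real. (\<And>j. 0 \<le> \<mu> j) \<Longrightarrow> (\<Sum>j=1..K. (\<mu> j)\<^sup>2) \<le> 1 \<Longrightarrow>
      norm (\<Sum>j=1..K. \<mu> j *\<^sub>R x j) \<le> B"
  shows "norm (\<Sum>j=1..K. x j) \<le> 2 * C * B"
proof -
  define U where "U i = half_open_cube (0 :: real ^ 'n) (2 ^ i)" for i :: nat
  define v where "v = measure lebesgue (U 0)"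
  define \<beta> :: real where "\<beta> = 2 ^ CARD('n)"
  define A where "A j = U j - U (j - 1)" for j
  define a where "a j Q = measure lebesgue (A j \<inter> Q) / measure lebesgue Q" for j Q
  \<comment> \<open>The share of \<open>U j\<close> that the annulus \<open>A j\<close> occupies,
    where \<open>\<beta>\<close> is the volume ratio of consecutive cubes. It is the largest share
    that \<open>A j\<close> has in a dyadic cube around a point of \<open>U 0\<close>, and at least
    1/2 in every dimension, whence the factor 2 in the conclusion.\<close>
  define \<theta> where "\<theta> = 1 - 1 / \<beta>"
  define f :: "real ^ 'n \<Rightarrow> 'x" where "f t = (\<Sum>j\<in>{1..K}. indicator (A j) t *\<^sub>R J (x j))" for t
  have B0: "0 \<le> B" using B[of "\<lambda>_. 0"] by simp
  have x0: "0 \<le> x j" if "j \<in> {1..K}" for j using x that by (simp add: disjoint_pos_def)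
  have \<beta>: "2 \<le> \<beta>"
  proof -
    have "(2::real) ^ 1 \<le> 2 ^ CARD('n)" by (intro power_increasing) (auto simp: Suc_le_eq)
    then show ?thesis by (simp add: \<beta>_def)
  qed
  then have \<theta>: "1 / 2 \<le> \<theta>" by (simp add: \<theta>_def field_simps)
  have \<theta>_eq: "(\<beta> ^ j - \<beta> ^ (j - 1)) / \<beta> ^ j = \<theta>" if "1 \<le> j" for j
    using \<beta> that by (cases j) (auto simp: \<theta>_def field_simps)
  have v: "0 < v" using measure_half_open_cube_pos by (simp add: v_def U_def)
  have Um: "U i \<in> lmeasurable" for i by (simp add: U_def half_open_cube_lmeasurable)
  have mU: "measure lebesgue (U i) = \<beta> ^ i * v" for i
    using measure_half_open_cube[of "2 ^ i", where 'n = 'n]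
    by (simp add: U_def v_def \<beta>_def power_mult[symmetric] mult.commute)
  have Umono: "U i \<subseteq> U j" if "i \<le> j" for i j
  proof -
    have "(2::real) ^ i \<le> 2 ^ j" using that by simp
    then show ?thesis by (auto simp: U_def half_open_cube_def intro: less_le_trans)
  qed
  have UD: "U i \<in> dyadic_cubes" for i by (simp add: U_def half_open_cube_dyadic)
  have Am: "A j \<in> lmeasurable" for j
    unfolding A_def using Um by (intro fmeasurable.Diff) auto
  have mA: "measure lebesgue (A j) = (\<beta> ^ j - \<beta> ^ (j - 1)) * v" for j
    unfolding A_def using Um Umono[of "j - 1" j]
    by (subst measurable_measure_Diff) (auto simp: mU algebra_simps)
  have aU: "a j (U i) = (if j \<le> i then (\<beta> ^ j - \<beta> ^ (j - 1)) / \<beta> ^ i else 0)" if "1 \<le> j" for i j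
  proof (cases "j \<le> i")
    case True
    then have "A j \<inter> U i = A j" using Umono[OF True] by (auto simp: A_def)
    then show ?thesis using True v \<beta> by (simp add: a_def mA mU)
  next
    case False
    then have "i \<le> j - 1" by simp
    from Umono[OF this] have "A j \<inter> U i = {}" by (auto simp: A_def)
    then show ?thesis using False by (simp add: a_def)
  qed
  have aS: "a j Q = 0" if "Q \<subseteq> U 0" for j Q
  proof -
    have "A j \<inter> Q = {}" using Umono[of 0 "j - 1"] that by (auto simp: A_def)
    then show ?thesis by (simp add: a_def)
  qed
  have a0: "0 \<le> a j Q" for j Q by (simp add: a_def)
  have cubes: "(\<exists>i. Q = U i) \<or> Q \<subseteq> U 0" if "Q \<in> dyadic_cubes" "s \<in> Q" "s \<in> U 0" for Q s
    using dyadic_cubes_containing[OF that(1,2)] that(3) by (simp add: U_def)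
  have a_le: "a j Q \<le> \<theta>" if "Q \<in> dyadic_cubes" "s \<in> Q" "s \<in> U 0" "1 \<le> j" for j Q s
    using cubes[OF that(1-3)]
  proof
    assume "\<exists>i. Q = U i"
    then obtain i where i: "Q = U i" by blast
    have "(\<beta> ^ j - \<beta> ^ (j - 1)) / \<beta> ^ i \<le> (\<beta> ^ j - \<beta> ^ (j - 1)) / \<beta> ^ j" if "j \<le> i"
      using that \<beta> by (intro divide_left_mono power_increasing mult_pos_pos) (auto intro: power_increasing)
    also have "(\<beta> ^ j - \<beta> ^ (j - 1)) / \<beta> ^ j = \<theta>" by (rule \<theta>_eq[OF \<open>1 \<le> j\<close>])
    finally show ?thesis using \<theta> aU[OF \<open>1 \<le> j\<close>] i by simp
  qed (use aS \<theta> in auto)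
  have row: "(\<Sum>j\<in>{1..K}. a j Q) \<le> 1" if "Q \<in> dyadic_cubes" "s \<in> Q" "s \<in> U 0" for Q s
    using cubes[OF that]
  proof
    assume "\<exists>i. Q = U i"
    then obtain i where i: "Q = U i" by blast
    have pos: "0 \<le> \<beta> ^ j - \<beta> ^ (j - 1)" for j using \<beta> by (auto intro: power_increasing)
    have "(\<Sum>j\<in>{1..K} \<inter> {..i}. \<beta> ^ j - \<beta> ^ (j - 1)) \<le> (\<Sum>j\<in>{1..i}. \<beta> ^ j - \<beta> ^ (j - 1))"
      using pos by (intro sum_mono2) auto
    also have "(\<Sum>j\<in>{1..i}. \<beta> ^ j - \<beta> ^ (j - 1)) = \<beta> ^ i - 1"
      by (induction i) auto
    finally have le: "(\<Sum>j\<in>{1..K} \<inter> {..i}. \<beta> ^ j - \<beta> ^ (j - 1)) \<le> \<beta> ^ i" by simp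
    have "(\<Sum>j\<in>{1..K}. a j Q)
        = (\<Sum>j\<in>{1..K}. if j \<in> {..i} then (\<beta> ^ j - \<beta> ^ (j - 1)) / \<beta> ^ i else 0)"
      using aU by (intro sum.cong) (auto simp: i)
    also have "\<dots> = (\<Sum>j\<in>{1..K} \<inter> {..i}. (\<beta> ^ j - \<beta> ^ (j - 1)) / \<beta> ^ i)"
      by (rule sum.inter_restrict[symmetric]) simp
    also have "\<dots> = (\<Sum>j\<in>{1..K} \<inter> {..i}. \<beta> ^ j - \<beta> ^ (j - 1)) / \<beta> ^ i"
      by (rule sum_divide_distrib[symmetric])
    also have "\<dots> \<le> \<beta> ^ i / \<beta> ^ i" using le \<beta> by (intro divide_right_mono) auto
    also have "\<dots> = 1" using \<beta> by simp
    finally show ?thesis .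
  qed (use aS in auto)
  \<comment> \<open>Among the cubes of \<open>F\<close>, only the \<open>U i\<close> with
    \<open>i \<ge> j\<close> meet \<open>A j\<close>, and the shares of \<open>A j\<close> in all
    such \<open>U i\<close> form a geometric series with sum 1.\<close>
  have col: "(\<Sum>Q\<in>F. a j Q) \<le> 1"
    if F: "finite F" "\<And>Q. Q \<in> F \<Longrightarrow> Q \<in> dyadic_cubes \<and> s \<in> Q" and s: "s \<in> U 0" and j: "1 \<le> j" for F s j
  proof -
    have inj: "inj U"
    proof (rule injI)
      fix i k assume "U i = U k"
      then have "\<beta> ^ i = \<beta> ^ k" using mU v by (metis mult_cancel_right less_irrefl)
      then show "i = k" using \<beta> by (simp add: power_inject_exp)
    qed
    have pos: "0 \<le> \<beta> ^ j - \<beta> ^ (j - 1)" using \<beta> by (auto intro: power_increasing)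
    define S where "S = {i. U i \<in> F \<and> j \<le> i}"
    have "finite S" using finite_vimageI[OF F(1) inj] by (rule finite_subset[rotated]) (auto simp: S_def)
    then obtain M where M: "S \<subseteq> {..M}" by (metis finite_nat_iff_bounded_le)
    have "(\<Sum>Q\<in>F. a j Q) = (\<Sum>Q\<in>U ` S. a j Q)"
    proof (rule sum.mono_neutral_right[OF F(1)])
      show "\<forall>Q\<in>F - U ` S. a j Q = 0"
      proof
        fix Q assume Q: "Q \<in> F - U ` S"
        then have "(\<exists>i. Q = U i) \<or> Q \<subseteq> U 0" using cubes F(2) s by blast
        then show "a j Q = 0"
        proof
          assume "\<exists>i. Q = U i"
          then obtain i where "Q = U i" by blast
          with Q have "\<not> j \<le> i" by (auto simp: S_def)
          then show ?thesis using aU[OF j] \<open>Q = U i\<close> by simp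
        qed (rule aS)
      qed
    qed (auto simp: S_def)
    also have "\<dots> = (\<Sum>i\<in>S. a j (U i))" by (simp add: sum.reindex inj_on_subset[OF inj])
    also have "\<dots> = (\<Sum>i\<in>S. (\<beta> ^ j - \<beta> ^ (j - 1)) / \<beta> ^ i)"
      using aU[OF j] by (intro sum.cong) (auto simp: S_def)
    \<comment> \<open>Extending the range to \<open>j + M\<close> makes it nonempty, so that the
      partial geometric sum has a closed form for every \<open>M\<close>.\<close>
    also have "\<dots> \<le> (\<Sum>i\<in>{j..j + M}. (\<beta> ^ j - \<beta> ^ (j - 1)) / \<beta> ^ i)"
      using pos \<beta> M by (intro sum_mono2) (auto simp: S_def)
    also have "\<dots> = 1 - 1 / \<beta> ^ Suc M"
    proof (induction M)
      case 0
      then show ?case using \<beta> j by (cases j) (auto simp: field_simps)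
    next
      case (Suc M)
      have "(\<beta> ^ j - \<beta> ^ (j - 1)) / \<beta> ^ (j + Suc M) = 1 / \<beta> ^ Suc M - 1 / \<beta> ^ Suc (Suc M)"
        using \<beta> j by (cases j) (auto simp: field_simps power_add)
      with Suc show ?case by simp
    qed
    also have "\<dots> \<le> 1" using \<beta> by simp
    finally show ?thesis .
  qed
  have fJ: "f t = J (\<Sum>j\<in>{1..K}. indicator (A j) t *\<^sub>R x j)" for t
    unfolding f_def using linear_J by (simp add: linear_sum linear_scale)
  have "0 \<le> (\<Sum>j\<in>{1..K}. indicator (A j) t *\<^sub>R x j)" for t
    using x0 by (intro sum_nonneg scaleR_nonneg_nonneg) auto
  then have abs_f: "(\<lambda>t. \<bar>f t\<bar>) = f" by (intro ext) (simp only: fJ abs_J abs_of_nonneg)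
  have indicator_simple: "simple_function (lebesgue_on Q) (indicator (A j) :: real ^ 'n \<Rightarrow> real)"
    if "Q \<in> lmeasurable" for Q j
  proof -
    have "simple_function lebesgue (\<lambda>t. indicator Q t *\<^sub>R indicator (A j) t :: real)"
      using that Am[of j]
      by (intro simple_function_compose2[where h = "(*\<^sub>R)"] simple_function_indicator) auto
    then show ?thesis using that by (subst simple_function_restrict_space) auto
  qed
  have avg: "average Q f = (\<Sum>j\<in>{1..K}. a j Q *\<^sub>R J (x j))" if "Q \<in> dyadic_cubes" for Q
  proof -
    have Qm: "Q \<in> lmeasurable" by (rule dyadic_cubes_lmeasurable[OF that])
    have "integral\<^sup>L (lebesgue_on Q) (indicator (A j) :: real ^ 'n \<Rightarrow> real) = measure lebesgue (A j \<inter> Q)" for j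
      using Qm by (simp add: measure_restrict_space)
    then show ?thesis
      unfolding f_def a_def
      by (subst average_sum_scaleR[OF Qm indicator_simple[OF Qm]]) auto
  qed
  have avgJ: "average Q f = J (\<Sum>j\<in>{1..K}. a j Q *\<^sub>R x j)" if "Q \<in> dyadic_cubes" for Q
    unfolding avg[OF that] using linear_J by (simp add: linear_sum linear_scale)
  have lat: "lattice_maximal dyadic_cubes f s = J (\<theta> *\<^sub>R (\<Sum>j\<in>{1..K}. x j))" if s: "s \<in> U 0" for s
    unfolding lattice_maximal_def abs_f
  proof (rule order_sup_eqI)
    fix y assume "y \<in> {average Q f |Q. Q \<in> dyadic_cubes \<and> s \<in> Q}"
    then obtain Q where Q: "Q \<in> dyadic_cubes" "s \<in> Q" "y = average Q f" by blast
    have "(\<Sum>j\<in>{1..K}. a j Q *\<^sub>R x j) \<le> (\<Sum>j\<in>{1..K}. \<theta> *\<^sub>R x j)"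
      using x0 a_le[OF Q(1,2) s] by (intro sum_mono scaleR_right_mono) auto
    then show "y \<le> J (\<theta> *\<^sub>R (\<Sum>j\<in>{1..K}. x j))"
      by (simp add: Q(3) avgJ[OF Q(1)] J_le_iff scaleR_sum_right)
  next
    fix b assume ub: "\<And>y. y \<in> {average Q f |Q. Q \<in> dyadic_cubes \<and> s \<in> Q} \<Longrightarrow> y \<le> b"
    have b: "J (\<Sum>j\<in>{1..K}. a j (U i) *\<^sub>R x j) \<le> b" for i
    proof -
      have "s \<in> U i" using Umono[of 0 i] s by auto
      then have "average (U i) f \<le> b" using UD[of i] by (intro ub) blast
      then show ?thesis by (simp only: avgJ[OF UD])
    qed
    \<comment> \<open>In the complexification, an element above one in the range of \<open>J\<close>
      has imaginary part 0 and lies in that range too; the supremum can thus be computed in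
      \<open>'a\<close>.\<close>
    then obtain y where y: "b = J y" using J_upper by blast
    have le: "(\<Sum>j\<in>{1..K}. a j (U i) *\<^sub>R x j) \<le> y" for i
      using b[of i] by (simp add: y J_le_iff)
    \<comment> \<open>Each cube \<open>U j\<close> guarantees only
      \<open>\<theta> *\<^sub>R x j\<close> below \<open>y\<close>; disjointness assembles these
      bounds into one for the sum.\<close>
    have "(\<Sum>j\<in>{1..K}. \<theta> *\<^sub>R x j) \<le> y"
    proof (rule disjoint_pos_sum_le)
      show "disjoint_pos {1..K} (\<lambda>j. \<theta> *\<^sub>R x j)" using x \<theta> by (intro disjoint_pos_scaleR) auto
      show "0 \<le> y" using le[of 0] aU[of _ 0] by simp
      fix j assume j: "j \<in> {1..K}"
      have "\<theta> = a j (U j)" using aU[of j j] \<theta>_eq[of j] j by simp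
      then have "\<theta> *\<^sub>R x j = (\<Sum>i\<in>{j}. a i (U j) *\<^sub>R x i)" by simp
      also have "\<dots> \<le> (\<Sum>i\<in>{1..K}. a i (U j) *\<^sub>R x i)"
        by (rule sum_mono2) (use j x0 a0 in \<open>auto intro: scaleR_nonneg_nonneg\<close>)
      finally have "\<theta> *\<^sub>R x j \<le> (\<Sum>i\<in>{1..K}. a i (U j) *\<^sub>R x i)" .
      then show "\<theta> *\<^sub>R x j \<le> y" using le[of j] by (rule order_trans)
    qed simp
    then show "J (\<theta> *\<^sub>R (\<Sum>j\<in>{1..K}. x j)) \<le> b"
      by (simp add: y J_le_iff scaleR_sum_right)
  qed
  have rad: "rademacher_maximal scl dyadic_cubes f s \<le> ennreal B" if s: "s \<in> U 0" for s
  proof (rule rademacher_maximal_le[OF B0])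
    fix F and c \<epsilon> :: "(real ^ 'n) set \<Rightarrow> 'k"
    assume F: "finite F" "\<And>Q. Q \<in> F \<Longrightarrow> Q \<in> dyadic_cubes \<and> s \<in> Q"
      and c: "(\<Sum>Q\<in>F. (norm (c Q))\<^sup>2) \<le> 1" and \<epsilon>: "\<And>Q. Q \<in> F \<Longrightarrow> norm (\<epsilon> Q) = 1"
    \<comment> \<open>Absolute values remove both the phases of \<open>c\<close> and the unimodular
      scalars. Schur's test then keeps \<open>\<mu>\<close> in the unit ball of
      \<open>l^2\<close>.\<close>
    define \<mu> where "\<mu> j = (\<Sum>Q\<in>F. norm (c Q) * a j Q)" for j
    have \<mu>0: "0 \<le> \<mu> j" for j using a0 by (auto simp: \<mu>_def intro!: sum_nonneg)
    have "(\<Sum>Q\<in>F. scl (\<epsilon> Q) (scl (c Q) (average Q f)))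
      = (\<Sum>Q\<in>F. \<Sum>j\<in>{1..K}. scl (a j Q *\<^sub>R (\<epsilon> Q * c Q)) (J (x j)))"
      using F(2) avg by (intro sum.cong) (auto simp: scl_scl scl_sum_right scl_scaleR)
    also have "\<dots> = (\<Sum>j\<in>{1..K}. scl (\<Sum>Q\<in>F. a j Q *\<^sub>R (\<epsilon> Q * c Q)) (J (x j)))"
      unfolding scl_sum_left by (rule sum.swap)
    finally have "norm (\<Sum>Q\<in>F. scl (\<epsilon> Q) (scl (c Q) (average Q f)))
      = norm (\<Sum>j\<in>{1..K}. scl (\<Sum>Q\<in>F. a j Q *\<^sub>R (\<epsilon> Q * c Q)) (J (x j)))" by simp
    also have "\<dots> \<le> norm (\<Sum>j\<in>{1..K}. \<mu> j *\<^sub>R x j)"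
    proof (rule norm_sum_scl_J_le)
      fix j
      have "norm (\<Sum>Q\<in>F. a j Q *\<^sub>R (\<epsilon> Q * c Q)) \<le> (\<Sum>Q\<in>F. norm (a j Q *\<^sub>R (\<epsilon> Q * c Q)))"
        by (rule norm_sum)
      also have "\<dots> = \<mu> j"
        unfolding \<mu>_def using \<epsilon> a0 by (intro sum.cong) (auto simp: norm_mult mult.commute)
      finally show "norm (\<Sum>Q\<in>F. a j Q *\<^sub>R (\<epsilon> Q * c Q)) \<le> \<mu> j" .
    qed (rule x0)
    also have "\<dots> \<le> B"
    proof (rule B[OF \<mu>0])
      have "(\<Sum>j=1..K. (\<mu> j)\<^sup>2) \<le> (\<Sum>Q\<in>F. (norm (c Q))\<^sup>2)"
        unfolding \<mu>_def
      proof (rule schur_test[OF a0])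
        show "(\<Sum>j=1..K. a j Q) \<le> 1" if "Q \<in> F" for Q using row F(2)[OF that] s by blast
        show "(\<Sum>Q\<in>F. a j Q) \<le> 1" if "j \<in> {1..K}" for j using that by (intro col[OF F s]) auto
      qed
      then show "(\<Sum>j=1..K. (\<mu> j)\<^sup>2) \<le> 1" using c by simp
    qed
    finally show "norm (\<Sum>Q\<in>F. scl (\<epsilon> Q) (scl (c Q) (average Q f))) \<le> B" .
  qed
  have "Bochner_Integration.simple_bochner_integrable lebesgue f"
  proof (rule Bochner_Integration.simple_bochner_integrable.intros)
    show "simple_function lebesgue f"
      unfolding f_def[abs_def] using Am
      by (intro simple_function_sum simple_function_compose1[where g = "\<lambda>r. r *\<^sub>R J (x _)"]
          simple_function_indicator) auto
    have "{t \<in> space lebesgue. f t \<noteq> 0} \<subseteq> U K"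
    proof (rule subsetI, rule ccontr)
      fix t assume t: "t \<in> {t \<in> space lebesgue. f t \<noteq> 0}" "t \<notin> U K"
      then have "t \<notin> A j" if "j \<in> {1..K}" for j using Umono[of j K] that by (auto simp: A_def)
      then have "f t = 0" unfolding f_def by (intro sum.neutral) simp
      then show False using t by simp
    qed
    then have "emeasure lebesgue {t \<in> space lebesgue. f t \<noteq> 0} \<le> emeasure lebesgue (U K)"
      using Um[of K] by (intro emeasure_mono) auto
    also have "\<dots> < \<infinity>" using fmeasurableD2[OF Um[of K]] by (simp only: less_top infinity_ennreal_def)
    finally show "emeasure lebesgue {t \<in> space lebesgue. f t \<noteq> 0} \<noteq> \<infinity>" by simp
  qed
  from H[OF this] have ae: "AE s in lebesgue. ennreal (norm (lattice_maximal dyadic_cubes f s))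
      \<le> ennreal C * rademacher_maximal scl dyadic_cubes f s" .
  \<comment> \<open>Both maximal functions are controlled at every point of \<open>U 0\<close>,
    which has positive measure, so one point where the comparison holds is enough.\<close>
  have "\<exists>s\<in>U 0. ennreal (norm (lattice_maximal dyadic_cubes f s))
      \<le> ennreal C * rademacher_maximal scl dyadic_cubes f s"
  proof (rule ccontr)
    assume "\<not> ?thesis"
    then have "AE s in lebesgue. s \<notin> U 0" using ae by (auto elim!: eventually_mono)
    then have "U 0 \<in> null_sets lebesgue" using Um[of 0] by (subst AE_iff_null_sets) auto
    from measure_eq_0_null_sets[OF this] show False using v by (simp add: v_def)
  qed
  then obtain s where s: "s \<in> U 0" "ennreal (norm (lattice_maximal dyadic_cubes f s))
      \<le> ennreal C * rademacher_maximal scl dyadic_cubes f s" by blast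
  have "ennreal (norm (lattice_maximal dyadic_cubes f s)) \<le> ennreal C * ennreal B"
    using s(2) mult_left_mono[OF rad[OF s(1)], of "ennreal C"] by (meson order_trans zero_le)
  also have "\<dots> = ennreal (C * B)" using C B0 by (simp add: ennreal_mult)
  finally have "norm (lattice_maximal dyadic_cubes f s) \<le> C * B" using C B0 by simp
  then have "\<theta> * norm (\<Sum>j=1..K. x j) \<le> C * B"
    unfolding lat[OF s(1)] using \<theta> by (simp add: norm_J)
  moreover have "(1 / 2) * norm (\<Sum>j=1..K. x j) \<le> \<theta> * norm (\<Sum>j=1..K. x j)"
    using \<theta> by (intro mult_right_mono) auto
  ultimately show ?thesis by simp
qed

text \<open>Two applications of the previous estimate suffice, because the product of two vectors in the
  unit ball of \<open>\<ell>\<^sup>2\<close> lies in the unit ball of \<open>\<ell>\<^sup>1\<close>.\<close>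

lemma maximal_comparison_c0:
  fixes x :: "'i \<Rightarrow> 'a"
  assumes C: "C > 0"
    and H: "\<And>f :: real ^ 'n \<Rightarrow> 'x. Bochner_Integration.simple_bochner_integrable lebesgue f \<Longrightarrow>
      AE s in lebesgue. ennreal (norm (lattice_maximal dyadic_cubes f s))
        \<le> ennreal C * rademacher_maximal scl dyadic_cubes f s"
    and I: "finite I" and x: "disjoint_pos I x" and one: "\<And>i. i \<in> I \<Longrightarrow> norm (x i) = 1"
  shows "norm (sum x I) \<le> 4 * C\<^sup>2"
proof -
  define K where "K = card I"
  obtain h where h: "bij_betw h {1..K} I" using ex_bij_betw_nat_finite_1[OF I] by (auto simp: K_def)
  define y where "y = x \<circ> h"
  have hI: "h j \<in> I" if "j \<in> {1..K}" for j using h that by (auto simp: bij_betw_def)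
  have "inf (y i) (y j) = 0" if "i \<in> {1..K}" "j \<in> {1..K}" "i \<noteq> j" for i j
  proof -
    have "h i \<noteq> h j" using h that by (meson bij_betw_imp_inj_on inj_onD)
    then show ?thesis using x hI[OF that(1)] hI[OF that(2)] by (simp add: disjoint_pos_def y_def)
  qed
  moreover have "0 \<le> y j" if "j \<in> {1..K}" for j
    using hI[OF that] x by (simp add: y_def disjoint_pos_def)
  ultimately have y: "disjoint_pos {1..K} y" by (simp add: disjoint_pos_def)
  have y1: "norm (y j) = 1" if "j \<in> {1..K}" for j using one hI[OF that] by (simp add: y_def)
  have "norm (\<Sum>j=1..K. y j) \<le> 2 * C * (2 * C * 1)"
  proof (rule maximal_comparison_l2[OF C H y])
    fix \<mu> :: "nat \<Rightarrow> real" assume \<mu>: "\<And>j. 0 \<le> \<mu> j" "(\<Sum>j=1..K. (\<mu> j)\<^sup>2) \<le> 1"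
    show "norm (\<Sum>j=1..K. \<mu> j *\<^sub>R y j) \<le> 2 * C * 1"
    proof (rule maximal_comparison_l2[OF C H disjoint_pos_scaleR[OF y \<mu>(1)]])
      fix \<nu> :: "nat \<Rightarrow> real" assume \<nu>: "\<And>j. 0 \<le> \<nu> j" "(\<Sum>j=1..K. (\<nu> j)\<^sup>2) \<le> 1"
      have "norm (\<Sum>j=1..K. \<nu> j *\<^sub>R \<mu> j *\<^sub>R y j) \<le> (\<Sum>j=1..K. norm (\<nu> j *\<^sub>R \<mu> j *\<^sub>R y j))"
        by (rule norm_sum)
      also have "\<dots> = (\<Sum>j=1..K. \<nu> j * \<mu> j)"
        using \<mu>(1) \<nu>(1) y1 by (intro sum.cong) auto
      also have "\<dots> \<le> (\<Sum>j=1..K. ((\<nu> j)\<^sup>2 + (\<mu> j)\<^sup>2) / 2)"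
        using sum_squares_bound by (intro sum_mono) (simp add: field_simps)
      also have "\<dots> \<le> 1" using \<mu>(2) \<nu>(2) by (simp add: sum_divide_distrib[symmetric] sum.distrib)
      finally show "norm (\<Sum>j=1..K. \<nu> j *\<^sub>R \<mu> j *\<^sub>R y j) \<le> 1" .
    qed auto
  qed auto
  also have "(\<Sum>j=1..K. y j) = sum x I"
    unfolding y_def using sum.reindex_bij_betw[OF h, of x] by simp
  finally show ?thesis by (simp add: power2_eq_square)
qed

lemma no_maximal_comparison:
  assumes "infinite_dimensional (scaleR :: real \<Rightarrow> 'a \<Rightarrow> 'a)" and "RMF_property scl"
  shows "\<not> (\<exists>C>0. \<forall>f :: real ^ 'n \<Rightarrow> 'x. Bochner_Integration.simple_bochner_integrable lebesgue f \<longrightarrow>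
      (AE s in lebesgue. ennreal (norm (lattice_maximal dyadic_cubes f s))
        \<le> ennreal C * rademacher_maximal scl dyadic_cubes f s))"
proof
  assume "\<exists>C>0. \<forall>f :: real ^ 'n \<Rightarrow> 'x. Bochner_Integration.simple_bochner_integrable lebesgue f \<longrightarrow>
      (AE s in lebesgue. ennreal (norm (lattice_maximal dyadic_cubes f s))
        \<le> ennreal C * rademacher_maximal scl dyadic_cubes f s)"
  then obtain C where C: "C > 0"
    and H: "\<And>f :: real ^ 'n \<Rightarrow> 'x. Bochner_Integration.simple_bochner_integrable lebesgue f \<Longrightarrow>
      AE s in lebesgue. ennreal (norm (lattice_maximal dyadic_cubes f s))
        \<le> ennreal C * rademacher_maximal scl dyadic_cubes f s" by blast
  show False
    by (rule RMF_unbounded_disjoint_sums[OF assms(2,1)]) (rule maximal_comparison_c0[OF C H])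
qed

end

section \<open>The real and the complex case\<close>

lemma lattice_scalars_real:
  "lattice_scalars (scaleR :: real \<Rightarrow> 'a::banach_lattice \<Rightarrow> 'a) (\<lambda>x. x) abs (\<lambda>_ v. v)"
  by standard (auto simp: algebra_simps abs_scaleR_lat abs_triangle_ineq linear_iff)

lemma lattice_scalars_complex:
  "lattice_scalars (scaleC :: complex \<Rightarrow> 'a::banach_lattice complexification \<Rightarrow> 'a complexification)
    (\<lambda>x. Cx x 0) lat_modulus (\<lambda>b. if b = 1 then rpart else ipart)"
proof (rule lattice_scalars.intro)
  have mod: "lat_modulus (Cx x 0) = \<bar>x\<bar>" for x :: 'a
    using abs_rpart_le[of "Cx x 0"] lat_modulus_le_sum[of "Cx x 0"] by (intro antisym) auto
  fix a b :: complex and v w :: "'a complexification" and r :: real and x y :: 'a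
  show "scaleC (a + b) v = scaleC a v + scaleC b v" by (rule complex_vector.scale_left_distrib)
  show "scaleC a (v + w) = scaleC a v + scaleC a w" by (rule complex_vector.scale_right_distrib)
  show "scaleC a (scaleC b v) = scaleC (a * b) v" by (rule complex_vector.scale_scale)
  show "scaleC (of_real r) v = r *\<^sub>R v" by (simp add: scaleC_def complexification_ops)
  show "norm (scaleC a v) = norm a * norm v" by (rule norm_scaleC)
  show "linear (\<lambda>x :: 'a. Cx x 0)" by (rule linearI) (simp_all add: complexification_ops)
  show "\<bar>Cx x 0\<bar> = Cx \<bar>x\<bar> 0" by (simp add: abs_complexification_def mod)
  show "Cx x 0 \<le> Cx y 0 \<longleftrightarrow> x \<le> y" by (simp add: less_eq_complexification_def)
  show "Cx x 0 \<le> w \<Longrightarrow> \<exists>y. w = Cx y 0" by (cases w) (auto simp: less_eq_complexification_def)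
  show "norm (lat_modulus v) = norm v" by (simp add: norm_complexification_def)
  show "lat_modulus (v + w) \<le> lat_modulus v + lat_modulus w" by (rule lat_modulus_triangle)
  show "lat_modulus (scaleC a (Cx x 0)) = norm a *\<^sub>R \<bar>x\<bar>" by (simp add: lat_modulus_scaleC mod)
  show "(if b = 1 then rpart else ipart) (v + w)
      = (if b = 1 then rpart else ipart) v + (if b = 1 then rpart else ipart) w"
    by (simp add: complexification_ops)
  show "b \<in> Basis \<Longrightarrow> (if b = 1 then rpart else ipart) (scaleC a (Cx x 0)) = (a \<bullet> b) *\<^sub>R x"
    by (auto simp: Basis_complex_def scaleC_def inner_complex_def)
  show "\<bar>(if b = 1 then rpart else ipart) v\<bar> \<le> lat_modulus v"
    by (simp add: abs_rpart_le abs_ipart_le)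
qed

text \<open>By contraposition: a finite set spanning \<open>'a\<close> over the reals also spans the
  complexification over the complex numbers, by splitting \<open>z\<close> into real and imaginary
  part.\<close>

lemma infinite_dimensional_real_part:
  assumes "infinite_dimensional
    (scaleC :: complex \<Rightarrow> 'a::banach_lattice complexification \<Rightarrow> 'a complexification)"
  shows "infinite_dimensional (scaleR :: real \<Rightarrow> 'a \<Rightarrow> 'a)"
  unfolding infinite_dimensional_def
proof
  assume "\<exists>B :: 'a set. finite B \<and> module.span (*\<^sub>R) B = UNIV"
  then obtain B :: "'a set" where B: "finite B" "span B = UNIV" by (auto simp: span_raw_def)
  let ?S = "complex_vector.span ((\<lambda>x. Cx x 0) ` B)"
  have J: "Cx x 0 \<in> ?S" for x
  proof -
    have "x \<in> span B" using B by simp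
    then show ?thesis
    proof (induction rule: span_induct_alt)
      case base
      then show ?case using complex_vector.span_zero[of "(\<lambda>x. Cx x 0) ` B"]
        by (simp add: zero_complexification_def)
    next
      case (step r x y)
      have "Cx (r *\<^sub>R x + y) 0 = scaleC (of_real r) (Cx x 0) + Cx y 0"
        by (simp add: scaleC_def complexification_ops)
      moreover have "scaleC (of_real r) (Cx x 0) \<in> ?S"
        using step by (intro complex_vector.span_scale complex_vector.span_base) auto
      ultimately show ?case using step by (metis complex_vector.span_add)
    qed
  qed
  have "z \<in> ?S" for z
  proof -
    have "z = Cx (rpart z) 0 + scaleC \<i> (Cx (ipart z) 0)"
      by (simp add: scaleC_def complexification_ops)
    then show ?thesis using J by (metis complex_vector.span_add complex_vector.span_scale)
  qed
  then have "?S = UNIV" by auto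
  with B(1) assms show False unfolding infinite_dimensional_def by blast
qed

theorem corollary8p2:
  shows
    "(infinite_dimensional (scaleR :: real \<Rightarrow> 'a::banach_lattice \<Rightarrow> 'a) \<and>
      RMF_property (scaleR :: real \<Rightarrow> 'a \<Rightarrow> 'a) \<longrightarrow>
      \<not> (\<exists>C>0. \<forall>f :: real ^ 'n \<Rightarrow> 'a.
          Bochner_Integration.simple_bochner_integrable lebesgue f \<longrightarrow>
          (AE s in lebesgue. ennreal (norm (lattice_maximal dyadic_cubes f s))
            \<le> ennreal C * rademacher_maximal scaleR dyadic_cubes f s)))
     \<and>
     (infinite_dimensional (scaleC :: complex \<Rightarrow> 'a complexification \<Rightarrow> 'a complexification) \<and>
      RMF_property (scaleC :: complex \<Rightarrow> 'a complexification \<Rightarrow> 'a complexification) \<longrightarrow>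
      \<not> (\<exists>C>0. \<forall>f :: real ^ 'n \<Rightarrow> 'a complexification.
          Bochner_Integration.simple_bochner_integrable lebesgue f \<longrightarrow>
          (AE s in lebesgue. ennreal (norm (lattice_maximal dyadic_cubes f s))
            \<le> ennreal C * rademacher_maximal scaleC dyadic_cubes f s)))"
  using lattice_scalars.no_maximal_comparison[OF lattice_scalars_real]
    lattice_scalars.no_maximal_comparison[OF lattice_scalars_complex infinite_dimensional_real_part]
  by blast

end
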